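(* Let $(\mathcal C,\mathbb E,\mathfrak s)$ be an extriangulated category with enough projectives and enough injectives, and let $\mathcal X$ be a functorially finite rigid subcategory of $\mathcal C$ such that $\mathcal A:=\mathcal X^{\perp_{\mathbb E}}={}^{\perp_{\mathbb E}}\mathcal X$ and $\mathrm{Proj}(\mathcal C),\mathrm{Inj}(\mathcal C)\subseteq\mathcal X$. Let $\mathcal U,\mathcal V$ be subcategories of $\mathcal C$ with $\mathcal X\subseteq\mathcal U\subseteq\mathcal X^{\perp_{\mathbb E}}$. Then $(\mathcal U,\mathcal V)$ is a cotorsion pair with core $I$ in $\mathcal C$ if and only if $(\overline{\mathcal U},\overline{\mathcal V})$ is a cotorsion pair with core $\overline I$ in the triangulated category $\mathcal M:=\mathcal A/\mathcal X$.
   Context: Conventions: all additive categories are Krull-Schmidt; a subcategory is a full subcategory closed under isomorphisms, finite direct sums and direct summands. Extriangulated category: a triple $(\mathcal C,\mathbb E,\mathfrak s)$ with $\mathcal C$ additive, $\mathbb E:\mathcal C^{\mathrm{op}}\times\mathcal C\to\mathrm{Ab}$ a biadditive functor, and $\mathfrak s$ assigning to each $\delta\in\mathbb E(C,A)$ an equivalence class $\mathfrak s(\delta)=[A\xrightarrow{x}B\xrightarrow{y}C]$ of sequences (equivalence: an isomorphism of middle terms compatible with the identities of the ends). One says $A\to B\to C$ realizes $\delta$ and calls $A\to B\to C\overset{\delta}{\dashrightarrow}$ an $\mathbb E$-triangle. Write $a_*\delta=\mathbb E(C,a)(\delta)$, $c^*\delta=\mathbb E(c,A)(\delta)$; a morphism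 $\delta\to\delta'$ with $\delta'\in\mathbb E(C',A')$ is a pair $(a:A\to A',c:C\to C')$ with $a_*\delta=c^*\delta'$. Axioms: every morphism $(a,c):\delta\to\delta'$ is realized by some $b$ with $bx=x'a$, $y'b=cy$; $\mathfrak s(0)$ is the split sequence and $\mathfrak s(\delta\oplus\delta')=\mathfrak s(\delta)\oplus\mathfrak s(\delta')$; (ET3) if $bx=x'a$ there is $c$ with $cy=y'b$ and $(a,c):\delta\to\delta'$ a morphism, and dually (ET3)$^{\rm op}$; (ET4) if $A\xrightarrow{f}B\xrightarrow{f'}D$ realizes $\delta$ and $B\xrightarrow{g}C\xrightarrow{g'}F$ realizes $\delta'$, there are an object $E$, morphisms $h':C\to E$, $d:D\to E$, $e:E\to F$ with $h'g=df'$, $eh'=g'$, and $\delta''\in\mathbb E(E,A)$ realized by $A\xrightarrow{gf}C\xrightarrow{h'}E$, such that $D\xrightarrow{d}E\xrightarrow{e}F$ realizes $f'_*\delta'$, $d^*\delta''=\delta$, $f_*\delta''=e^*\delta'$; and dually (ET4)$^{\rm op}$. $P$ is projective if every morphism $P\to C$ lifts along $y$ for every $\mathbb E$-triangle $A\to B\xrightarrow{y}C\dashrightarrow$; injectives are dual. $\mathrm{Proj}(\mathcal C)$, $\mathrm{Inj}(\mathcal C)$ denote the corresponding subcategories. Enough projectives: every $C$ has an $\mathbb E$-triangle $A\to P\to C\dashrightarrow$ with $P$ projective; enough injectives dually. $\mathcal X$ is rigid if $\mathbb E(\mathcal X,\mathcal X)=0$. $\mathcal X^{\perp_{\mathbb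 E}}=\{M\mid\mathbb E(\mathcal X,M)=0\}$, ${}^{\perp_{\mathbb E}}\mathcal X=\{M\mid\mathbb E(M,\mathcal X)=0\}$. A cotorsion pair $(\mathcal U,\mathcal V)$ in an extriangulated category is a pair of subcategories with $\mathbb E(\mathcal U,\mathcal V)=0$ such that every object $C$ admits $\mathbb E$-triangles $V\to U\to C\dashrightarrow$ and $C\to V'\to U'\dashrightarrow$ with $U,U'\in\mathcal U$, $V,V'\in\mathcal V$; its core is $\mathcal U\cap\mathcal V$. For a triangulated category with shift $\langle1\rangle$ this is applied with $\mathbb E(C,A)=\mathrm{Hom}(C,A\langle1\rangle)$ and $\mathbb E$-triangles given by triangles. $\mathcal A/\mathcal X$ has the objects of $\mathcal A$ and morphisms modulo those factoring through $\mathcal X$; $\overline f$ is the class of $f$. It is triangulated as follows: for $A\in\mathcal A$ choose an $\mathbb E$-triangle $A\xrightarrow{a}X\xrightarrow{b}A\langle1\rangle\dashrightarrow$ with $A\langle 1\rangle\in\mathcal A$, $a$ a left and $b$ a right $\mathcal X$-approximation; $\langle1\rangle$ is the shift. For an $\mathbb E$-triangle $A\xrightarrow{f}B\xrightarrow{g}C\dashrightarrow$ in $\mathcal A$ such that every morphism from $A$ to an object of $\mathcal X$ factors through $f$, choose a morphism of $\mathbb E$-triangles $(1_A,*,h)$ to $A\to X\to A\langle1\rangle\dashrightarrow$; triangles are the complexes isomorphic to $A\xrightarrow{\overline f}B\xrightarrow{\overline g}C\xrightarrow{\overline h}A\langle1\rangle$. For a subcategory $\mathcal B$ with $\mathcal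 X\subseteq\mathcal B\subseteq\mathcal A$, $\overline{\mathcal B}$ is the subcategory of $\mathcal M$ with the objects of $\mathcal B$. The assertion that $(\overline{\mathcal U},\overline{\mathcal V})$ is a cotorsion pair in $\mathcal M$ presupposes $\mathcal X\subseteq\mathcal V\subseteq\mathcal A$. *)

theory Defs
  imports "HOL-Algebra.Coset"
begin

text \<open>
  Each hom-set carries its abelian group structure as a HOL-Algebra group, which is written
  multiplicatively: in \<open>Hom C A B\<close> the sum of morphisms is \<open>\<otimes>\<close> and the zero morphism is \<open>\<one>\<close>.
  The same convention applies to the groups \<open>Ext C Z A\<close> of extensions below.
  The composite \<open>g \<cdot> f\<close> is \<open>g\<close> after \<open>f\<close>.
\<close>

record ('o, 'm) cat_data =
  Obj :: "'o set"
  Hom :: "'o \<Rightarrow> 'o \<Rightarrow> 'm monoid"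
  Cmp :: "'m \<Rightarrow> 'm \<Rightarrow> 'm" (infixl "\<cdot>\<index>" 70)
  Idn :: "'o \<Rightarrow> 'm"

definition arr :: "('o, 'm, 'z) cat_data_scheme \<Rightarrow> 'o \<Rightarrow> 'o \<Rightarrow> 'm set" where
  "arr C A B = {f. A \<in> Obj C \<and> B \<in> Obj C \<and> f \<in> carrier (Hom C A B)}"

definition is_iso :: "('o, 'm, 'z) cat_data_scheme \<Rightarrow> 'o \<Rightarrow> 'o \<Rightarrow> 'm \<Rightarrow> bool" where
  "is_iso C A B f \<longleftrightarrow> f \<in> arr C A B \<and>
     (\<exists>g \<in> arr C B A. g \<cdot>\<^bsub>C\<^esub> f = Idn C A \<and> f \<cdot>\<^bsub>C\<^esub> g = Idn C B)"

definition zero_object :: "('o, 'm, 'z) cat_data_scheme \<Rightarrow> 'o \<Rightarrow> bool" where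
  "zero_object C Z \<longleftrightarrow> Z \<in> Obj C \<and>
     (\<forall>A \<in> Obj C. (\<exists>!f. f \<in> arr C A Z) \<and> (\<exists>!f. f \<in> arr C Z A))"

definition biproduct ::
  "('o, 'm, 'z) cat_data_scheme \<Rightarrow> 'o \<Rightarrow> 'o \<Rightarrow> 'o \<Rightarrow> 'm \<Rightarrow> 'm \<Rightarrow> 'm \<Rightarrow> 'm \<Rightarrow> bool" where
  "biproduct C A B S i j p q \<longleftrightarrow>
     i \<in> arr C A S \<and> j \<in> arr C B S \<and> p \<in> arr C S A \<and> q \<in> arr C S B \<and>
     p \<cdot>\<^bsub>C\<^esub> i = Idn C A \<and> q \<cdot>\<^bsub>C\<^esub> j = Idn C B \<and>
     q \<cdot>\<^bsub>C\<^esub> i = \<one>\<^bsub>Hom C A B\<^esub> \<and> p \<cdot>\<^bsub>C\<^esub> j = \<one>\<^bsub>Hom C B A\<^esub> \<and>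
     (i \<cdot>\<^bsub>C\<^esub> p) \<otimes>\<^bsub>Hom C S S\<^esub> (j \<cdot>\<^bsub>C\<^esub> q) = Idn C S"

definition direct_sum :: "('o, 'm, 'z) cat_data_scheme \<Rightarrow> 'o \<Rightarrow> 'o \<Rightarrow> 'o \<Rightarrow> bool" where
  "direct_sum C A B S \<longleftrightarrow> (\<exists>i j p q. biproduct C A B S i j p q)"

primrec finite_direct_sum ::
  "('o, 'm, 'z) cat_data_scheme \<Rightarrow> 'o list \<Rightarrow> 'o \<Rightarrow> bool" where
  "finite_direct_sum C [] S \<longleftrightarrow> zero_object C S"
| "finite_direct_sum C (A # As) S \<longleftrightarrow> (\<exists>T. finite_direct_sum C As T \<and> direct_sum C A T S)"

text \<open>
  Composition and identities do not mention objects explicitly, so a morphism has to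
  determine its domain and codomain.
\<close>

locale additive_category =
  fixes C :: "('o, 'm, 'z) cat_data_scheme" (structure)
  assumes hom_disjoint:
      "\<lbrakk>f \<in> arr C A B; f \<in> arr C A' B'\<rbrakk> \<Longrightarrow> A = A' \<and> B = B'"
    and hom_group: "\<lbrakk>A \<in> Obj C; B \<in> Obj C\<rbrakk> \<Longrightarrow> comm_group (Hom C A B)"
    and id_arr: "A \<in> Obj C \<Longrightarrow> Idn C A \<in> arr C A A"
    and comp_arr: "\<lbrakk>f \<in> arr C A B; g \<in> arr C B D\<rbrakk> \<Longrightarrow> g \<cdot> f \<in> arr C A D"
    and comp_assoc:
      "\<lbrakk>f \<in> arr C A B; g \<in> arr C B D; h \<in> arr C D E\<rbrakk> \<Longrightarrow> h \<cdot> (g \<cdot> f) = (h \<cdot> g) \<cdot> f"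
    and id_left: "f \<in> arr C A B \<Longrightarrow> Idn C B \<cdot> f = f"
    and id_right: "f \<in> arr C A B \<Longrightarrow> f \<cdot> Idn C A = f"
    and comp_add_left:
      "\<lbrakk>f \<in> arr C A B; D \<in> Obj C\<rbrakk> \<Longrightarrow> (\<lambda>g. g \<cdot> f) \<in> hom (Hom C B D) (Hom C A D)"
    and comp_add_right:
      "\<lbrakk>g \<in> arr C B D; A \<in> Obj C\<rbrakk> \<Longrightarrow> (\<lambda>f. g \<cdot> f) \<in> hom (Hom C A B) (Hom C A D)"
    and has_zero_object: "\<exists>Z. zero_object C Z"
    and has_direct_sums: "\<lbrakk>A \<in> Obj C; B \<in> Obj C\<rbrakk> \<Longrightarrow> \<exists>S. direct_sum C A B S"

text \<open>The endomorphism ring of \<open>A\<close> is local: it is nonzero and a sum of two non-units is a non-unit.\<close>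

definition local_endomorphism_ring :: "('o, 'm, 'z) cat_data_scheme \<Rightarrow> 'o \<Rightarrow> bool" where
  "local_endomorphism_ring C A \<longleftrightarrow> A \<in> Obj C \<and> Idn C A \<noteq> \<one>\<^bsub>Hom C A A\<^esub> \<and>
     (\<forall>f \<in> arr C A A. \<forall>g \<in> arr C A A.
        is_iso C A A (f \<otimes>\<^bsub>Hom C A A\<^esub> g) \<longrightarrow> is_iso C A A f \<or> is_iso C A A g)"

definition krull_schmidt :: "('o, 'm, 'z) cat_data_scheme \<Rightarrow> bool" where
  "krull_schmidt C \<longleftrightarrow>
     (\<forall>A \<in> Obj C. \<exists>As. (\<forall>B \<in> set As. local_endomorphism_ring C B) \<and> finite_direct_sum C As A)"

text \<open>
  A full subcategory is represented by its class of objects. In particular the subcategory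
  of a quotient category having the same objects as \<open>B\<close> is again the set \<open>B\<close>.
\<close>

definition subcategory :: "('o, 'm, 'z) cat_data_scheme \<Rightarrow> 'o set \<Rightarrow> bool" where
  "subcategory C B \<longleftrightarrow> B \<subseteq> Obj C \<and>
     (\<forall>S T f. S \<in> B \<and> is_iso C S T f \<longrightarrow> T \<in> B) \<and>
     (\<forall>Z. zero_object C Z \<longrightarrow> Z \<in> B) \<and>
     (\<forall>S T D. S \<in> B \<and> T \<in> B \<and> direct_sum C S T D \<longrightarrow> D \<in> B) \<and>
     (\<forall>S T D. D \<in> B \<and> direct_sum C S T D \<longrightarrow> S \<in> B \<and> T \<in> B)"

definition left_approx :: "('o, 'm, 'z) cat_data_scheme \<Rightarrow> 'o set \<Rightarrow> 'o \<Rightarrow> 'o \<Rightarrow> 'm \<Rightarrow> bool" where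
  "left_approx C X A Y f \<longleftrightarrow> Y \<in> X \<and> f \<in> arr C A Y \<and>
     (\<forall>Y' \<in> X. \<forall>g \<in> arr C A Y'. \<exists>h \<in> arr C Y Y'. g = h \<cdot>\<^bsub>C\<^esub> f)"

definition right_approx :: "('o, 'm, 'z) cat_data_scheme \<Rightarrow> 'o set \<Rightarrow> 'o \<Rightarrow> 'o \<Rightarrow> 'm \<Rightarrow> bool" where
  "right_approx C X Y A f \<longleftrightarrow> Y \<in> X \<and> f \<in> arr C Y A \<and>
     (\<forall>Y' \<in> X. \<forall>g \<in> arr C Y' A. \<exists>h \<in> arr C Y' Y. g = f \<cdot>\<^bsub>C\<^esub> h)"

definition functorially_finite :: "('o, 'm, 'z) cat_data_scheme \<Rightarrow> 'o set \<Rightarrow> bool" where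
  "functorially_finite C X \<longleftrightarrow>
     (\<forall>A \<in> Obj C. (\<exists>Y f. left_approx C X A Y f) \<and> (\<exists>Y f. right_approx C X Y A f))"

text \<open>
  For \<open>a : A \<rightarrow> A'\<close>, \<open>c : Z' \<rightarrow> Z\<close> and \<open>\<delta>\<close> in \<open>Ext S Z A\<close> we have
  \<open>Push S Z a \<delta> = a\<^sub>* \<delta>\<close> and \<open>Pull S c A \<delta> = c\<^sup>* \<delta>\<close>.
  The equivalence class assigned to \<open>\<delta>\<close> is \<open>Real S Z A \<delta>\<close>; a sequence \<open>A \<rightarrow> B \<rightarrow> Z\<close>
  with morphisms \<open>x\<close>, \<open>y\<close> is recorded as the triple \<open>(B, x, y)\<close>.
\<close>

record ('o, 'm, 'e) ext_data = "('o, 'm) cat_data" +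
  Ext :: "'o \<Rightarrow> 'o \<Rightarrow> 'e monoid"
  Push :: "'o \<Rightarrow> 'm \<Rightarrow> 'e \<Rightarrow> 'e"
  Pull :: "'m \<Rightarrow> 'o \<Rightarrow> 'e \<Rightarrow> 'e"
  Real :: "'o \<Rightarrow> 'o \<Rightarrow> 'e \<Rightarrow> ('o \<times> 'm \<times> 'm) set"

definition exts :: "('o, 'm, 'e, 'z) ext_data_scheme \<Rightarrow> 'o \<Rightarrow> 'o \<Rightarrow> 'e set" where
  "exts S Z A = {\<delta>. Z \<in> Obj S \<and> A \<in> Obj S \<and> \<delta> \<in> carrier (Ext S Z A)}"

definition seq_class ::
  "('o, 'm, 'z) cat_data_scheme \<Rightarrow> 'o \<Rightarrow> 'm \<Rightarrow> 'o \<Rightarrow> 'm \<Rightarrow> 'o \<Rightarrow> ('o \<times> 'm \<times> 'm) set" where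
  "seq_class C A x B y Z =
     {(B', x', y'). x' \<in> arr C A B' \<and> y' \<in> arr C B' Z \<and>
        (\<exists>b. is_iso C B B' b \<and> b \<cdot>\<^bsub>C\<^esub> x = x' \<and> y' \<cdot>\<^bsub>C\<^esub> b = y)}"

definition etriangle ::
  "('o, 'm, 'e, 'z) ext_data_scheme \<Rightarrow> 'o \<Rightarrow> 'm \<Rightarrow> 'o \<Rightarrow> 'm \<Rightarrow> 'o \<Rightarrow> 'e \<Rightarrow> bool" where
  "etriangle S A x B y Z \<delta> \<longleftrightarrow> \<delta> \<in> exts S Z A \<and> (B, x, y) \<in> Real S Z A \<delta>"

definition ext_morphism ::
  "('o, 'm, 'e, 'z) ext_data_scheme \<Rightarrow> 'o \<Rightarrow> 'o \<Rightarrow> 'e \<Rightarrow> 'o \<Rightarrow> 'o \<Rightarrow> 'e \<Rightarrow> 'm \<Rightarrow> 'm \<Rightarrow> bool" where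
  "ext_morphism S A Z \<delta> A' Z' \<delta>' a c \<longleftrightarrow>
     a \<in> arr S A A' \<and> c \<in> arr S Z Z' \<and> Push S Z a \<delta> = Pull S c A' \<delta>'"

definition etriangle_morphism ::
  "('o, 'm, 'e, 'z) ext_data_scheme \<Rightarrow>
   'o \<Rightarrow> 'm \<Rightarrow> 'o \<Rightarrow> 'm \<Rightarrow> 'o \<Rightarrow> 'e \<Rightarrow> 'o \<Rightarrow> 'm \<Rightarrow> 'o \<Rightarrow> 'm \<Rightarrow> 'o \<Rightarrow> 'e \<Rightarrow> 'm \<Rightarrow> 'm \<Rightarrow> 'm \<Rightarrow> bool" where
  "etriangle_morphism S A x B y Z \<delta> A' x' B' y' Z' \<delta>' a b c \<longleftrightarrow>
     ext_morphism S A Z \<delta> A' Z' \<delta>' a c \<and> b \<in> arr S B B' \<and>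
     b \<cdot>\<^bsub>S\<^esub> x = x' \<cdot>\<^bsub>S\<^esub> a \<and> y' \<cdot>\<^bsub>S\<^esub> b = c \<cdot>\<^bsub>S\<^esub> y"

text \<open>
  In \<open>real_sum\<close> the extension \<open>\<delta> \<oplus> \<delta>'\<close> in \<open>Ext S (Z \<oplus> Z') (A \<oplus> A')\<close> is written as
  \<open>(i\<^sub>A)\<^sub>* (p\<^sub>Z)\<^sup>* \<delta> + (j\<^sub>A)\<^sub>* (q\<^sub>Z)\<^sup>* \<delta>'\<close>, where \<open>i, j\<close> and \<open>p, q\<close> are the injections and
  projections of the respective direct sums.
\<close>

locale extriangulated_category = additive_category S
  for S :: "('o, 'm, 'e, 'z) ext_data_scheme" (structure) +
  assumes ext_group: "\<lbrakk>Z \<in> Obj S; A \<in> Obj S\<rbrakk> \<Longrightarrow> comm_group (Ext S Z A)"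
    and push_hom:
      "\<lbrakk>Z \<in> Obj S; a \<in> arr S A A'\<rbrakk> \<Longrightarrow> Push S Z a \<in> hom (Ext S Z A) (Ext S Z A')"
    and pull_hom:
      "\<lbrakk>A \<in> Obj S; c \<in> arr S Z' Z\<rbrakk> \<Longrightarrow> Pull S c A \<in> hom (Ext S Z A) (Ext S Z' A)"
    and push_id: "\<delta> \<in> exts S Z A \<Longrightarrow> Push S Z (Idn S A) \<delta> = \<delta>"
    and pull_id: "\<delta> \<in> exts S Z A \<Longrightarrow> Pull S (Idn S Z) A \<delta> = \<delta>"
    and push_comp:
      "\<lbrakk>\<delta> \<in> exts S Z A; a \<in> arr S A A'; a' \<in> arr S A' A''\<rbrakk>
        \<Longrightarrow> Push S Z (a' \<cdot> a) \<delta> = Push S Z a' (Push S Z a \<delta>)"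
    and pull_comp:
      "\<lbrakk>\<delta> \<in> exts S Z A; c \<in> arr S Z' Z; c' \<in> arr S Z'' Z'\<rbrakk>
        \<Longrightarrow> Pull S (c \<cdot> c') A \<delta> = Pull S c' A (Pull S c A \<delta>)"
    and push_pull:
      "\<lbrakk>\<delta> \<in> exts S Z A; a \<in> arr S A A'; c \<in> arr S Z' Z\<rbrakk>
        \<Longrightarrow> Push S Z' a (Pull S c A \<delta>) = Pull S c A' (Push S Z a \<delta>)"
    and push_add:
      "\<lbrakk>\<delta> \<in> exts S Z A; a \<in> arr S A A'; a' \<in> arr S A A'\<rbrakk>
        \<Longrightarrow> Push S Z (a \<otimes>\<^bsub>Hom S A A'\<^esub> a') \<delta> = Push S Z a \<delta> \<otimes>\<^bsub>Ext S Z A'\<^esub> Push S Z a' \<delta>"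
    and pull_add:
      "\<lbrakk>\<delta> \<in> exts S Z A; c \<in> arr S Z' Z; c' \<in> arr S Z' Z\<rbrakk>
        \<Longrightarrow> Pull S (c \<otimes>\<^bsub>Hom S Z' Z\<^esub> c') A \<delta> = Pull S c A \<delta> \<otimes>\<^bsub>Ext S Z' A\<^esub> Pull S c' A \<delta>"
    and real_class:
      "\<delta> \<in> exts S Z A \<Longrightarrow>
        \<exists>B x y. x \<in> arr S A B \<and> y \<in> arr S B Z \<and> Real S Z A \<delta> = seq_class S A x B y Z"
    and real_morphism:
      "\<lbrakk>etriangle S A x B y Z \<delta>; etriangle S A' x' B' y' Z' \<delta>';
        ext_morphism S A Z \<delta> A' Z' \<delta>' a c\<rbrakk>
        \<Longrightarrow> \<exists>b \<in> arr S B B'. b \<cdot> x = x' \<cdot> a \<and> y' \<cdot> b = c \<cdot> y"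
    and real_zero:
      "biproduct S A Z B i j p q \<Longrightarrow> (B, i, q) \<in> Real S Z A \<one>\<^bsub>Ext S Z A\<^esub>"
    and real_sum:
      "\<lbrakk>etriangle S A x B y Z \<delta>; etriangle S A' x' B' y' Z' \<delta>';
        biproduct S A A' SA iA jA pA qA;
        biproduct S B B' SB iB jB pB qB;
        biproduct S Z Z' SZ iZ jZ pZ qZ\<rbrakk>
        \<Longrightarrow> (SB,
             (iB \<cdot> x \<cdot> pA) \<otimes>\<^bsub>Hom S SA SB\<^esub> (jB \<cdot> x' \<cdot> qA),
             (iZ \<cdot> y \<cdot> pB) \<otimes>\<^bsub>Hom S SB SZ\<^esub> (jZ \<cdot> y' \<cdot> qB))
            \<in> Real S SZ SA
                (Push S SZ iA (Pull S pZ A \<delta>) \<otimes>\<^bsub>Ext S SZ SA\<^esub> Push S SZ jA (Pull S qZ A' \<delta>'))"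
    and ET3:
      "\<lbrakk>etriangle S A x B y Z \<delta>; etriangle S A' x' B' y' Z' \<delta>';
        a \<in> arr S A A'; b \<in> arr S B B'; b \<cdot> x = x' \<cdot> a\<rbrakk>
        \<Longrightarrow> \<exists>c. c \<cdot> y = y' \<cdot> b \<and> ext_morphism S A Z \<delta> A' Z' \<delta>' a c"
    and ET3_op:
      "\<lbrakk>etriangle S A x B y Z \<delta>; etriangle S A' x' B' y' Z' \<delta>';
        b \<in> arr S B B'; c \<in> arr S Z Z'; y' \<cdot> b = c \<cdot> y\<rbrakk>
        \<Longrightarrow> \<exists>a. x' \<cdot> a = b \<cdot> x \<and> ext_morphism S A Z \<delta> A' Z' \<delta>' a c"
    and ET4:
      "\<lbrakk>etriangle S A f B f' D \<delta>; etriangle S B g C g' F \<delta>'\<rbrakk>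
        \<Longrightarrow> \<exists>E h' d e \<delta>''.
              h' \<in> arr S C E \<and> d \<in> arr S D E \<and> e \<in> arr S E F \<and>
              h' \<cdot> g = d \<cdot> f' \<and> e \<cdot> h' = g' \<and>
              etriangle S A (g \<cdot> f) C h' E \<delta>'' \<and>
              etriangle S D d E e F (Push S F f' \<delta>') \<and>
              Pull S d A \<delta>'' = \<delta> \<and>
              Push S E f \<delta>'' = Pull S e B \<delta>'"
    and ET4_op:
      "\<lbrakk>etriangle S D f' B f A \<delta>; etriangle S F g' C g B \<delta>'\<rbrakk>
        \<Longrightarrow> \<exists>E h' d e \<delta>''.
              h' \<in> arr S E C \<and> d \<in> arr S E D \<and> e \<in> arr S F E \<and>
              g \<cdot> h' = f' \<cdot> d \<and> h' \<cdot> e = g' \<and>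
              etriangle S E h' C (f \<cdot> g) A \<delta>'' \<and>
              etriangle S F e E d D (Pull S f' F \<delta>') \<and>
              Push S A d \<delta>'' = \<delta> \<and>
              Pull S f E \<delta>'' = Push S B e \<delta>'"

definition projective_objects :: "('o, 'm, 'e, 'z) ext_data_scheme \<Rightarrow> 'o set" where
  "projective_objects S = {P \<in> Obj S.
     \<forall>A x B y Z \<delta>. etriangle S A x B y Z \<delta> \<longrightarrow>
       (\<forall>f \<in> arr S P Z. \<exists>g \<in> arr S P B. y \<cdot>\<^bsub>S\<^esub> g = f)}"

definition injective_objects :: "('o, 'm, 'e, 'z) ext_data_scheme \<Rightarrow> 'o set" where
  "injective_objects S = {I \<in> Obj S.
     \<forall>A x B y Z \<delta>. etriangle S A x B y Z \<delta> \<longrightarrow>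
       (\<forall>f \<in> arr S A I. \<exists>g \<in> arr S B I. g \<cdot>\<^bsub>S\<^esub> x = f)}"

definition enough_projectives :: "('o, 'm, 'e, 'z) ext_data_scheme \<Rightarrow> bool" where
  "enough_projectives S \<longleftrightarrow>
     (\<forall>Z \<in> Obj S. \<exists>A x P y \<delta>. P \<in> projective_objects S \<and> etriangle S A x P y Z \<delta>)"

definition enough_injectives :: "('o, 'm, 'e, 'z) ext_data_scheme \<Rightarrow> bool" where
  "enough_injectives S \<longleftrightarrow>
     (\<forall>A \<in> Obj S. \<exists>x I y Z \<delta>. I \<in> injective_objects S \<and> etriangle S A x I y Z \<delta>)"

definition ext_vanishes :: "('o, 'm, 'e, 'z) ext_data_scheme \<Rightarrow> 'o set \<Rightarrow> 'o set \<Rightarrow> bool" where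
  "ext_vanishes S U V \<longleftrightarrow> (\<forall>Z \<in> U. \<forall>A \<in> V. carrier (Ext S Z A) = {\<one>\<^bsub>Ext S Z A\<^esub>})"

definition rigid :: "('o, 'm, 'e, 'z) ext_data_scheme \<Rightarrow> 'o set \<Rightarrow> bool" where
  "rigid S X \<longleftrightarrow> ext_vanishes S X X"

definition right_perp :: "('o, 'm, 'e, 'z) ext_data_scheme \<Rightarrow> 'o set \<Rightarrow> 'o set" where
  "right_perp S X = {M \<in> Obj S. ext_vanishes S X {M}}"

definition left_perp :: "('o, 'm, 'e, 'z) ext_data_scheme \<Rightarrow> 'o set \<Rightarrow> 'o set" where
  "left_perp S X = {M \<in> Obj S. ext_vanishes S {M} X}"

text \<open>
  The following definition is applied both to extriangulated categories and, via
  \<open>ext_of_triangulated\<close> below, to triangulated categories.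
\<close>

definition cotorsion_pair :: "('o, 'm, 'e, 'z) ext_data_scheme \<Rightarrow> 'o set \<Rightarrow> 'o set \<Rightarrow> bool" where
  "cotorsion_pair S U V \<longleftrightarrow>
     subcategory S U \<and> subcategory S V \<and> ext_vanishes S U V \<and>
     (\<forall>C \<in> Obj S.
        (\<exists>V0 x U0 y \<delta>. V0 \<in> V \<and> U0 \<in> U \<and> etriangle S V0 x U0 y C \<delta>) \<and>
        (\<exists>x V1 y U1 \<delta>. V1 \<in> V \<and> U1 \<in> U \<and> etriangle S C x V1 y U1 \<delta>))"

definition cotorsion_pair_with_core ::
  "('o, 'm, 'e, 'z) ext_data_scheme \<Rightarrow> 'o set \<Rightarrow> 'o set \<Rightarrow> 'o set \<Rightarrow> bool" where
  "cotorsion_pair_with_core S U V I \<longleftrightarrow> cotorsion_pair S U V \<and> I = U \<inter> V"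

text \<open>
  \<open>Tri T\<close> holds for \<open>A, f, B, g, Z, h\<close> if \<open>A \<rightarrow> B \<rightarrow> Z \<rightarrow> A\<langle>1\<rangle>\<close> with morphisms \<open>f, g, h\<close> is a triangle.
\<close>

record ('o, 'm) tri_data = "('o, 'm) cat_data" +
  Shift :: "'o \<Rightarrow> 'o"
  ShiftM :: "'m \<Rightarrow> 'm"
  Tri :: "'o \<Rightarrow> 'm \<Rightarrow> 'o \<Rightarrow> 'm \<Rightarrow> 'o \<Rightarrow> 'm \<Rightarrow> bool"

definition ext_of_triangulated :: "('o, 'm, 'z) tri_data_scheme \<Rightarrow> ('o, 'm, 'm) ext_data" where
  "ext_of_triangulated T = \<lparr>
     Obj = Obj T, Hom = Hom T, Cmp = Cmp T, Idn = Idn T,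
     Ext = (\<lambda>Z A. Hom T Z (Shift T A)),
     Push = (\<lambda>Z a \<delta>. ShiftM T a \<cdot>\<^bsub>T\<^esub> \<delta>),
     Pull = (\<lambda>c A \<delta>. \<delta> \<cdot>\<^bsub>T\<^esub> c),
     Real = (\<lambda>Z A \<delta>. {(B, x, y). Tri T A x B y Z \<delta>})\<rparr>"

definition full_subcategory ::
  "('o, 'm, 'z) cat_data_scheme \<Rightarrow> 'o set \<Rightarrow> ('o, 'm) cat_data" where
  "full_subcategory C A = \<lparr>Obj = A, Hom = Hom C, Cmp = Cmp C, Idn = Idn C\<rparr>"

definition factoring ::
  "('o, 'm, 'z) cat_data_scheme \<Rightarrow> 'o set \<Rightarrow> 'o \<Rightarrow> 'o \<Rightarrow> 'm set" where
  "factoring C X A B =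
     {f \<in> arr C A B. \<exists>Y \<in> X. \<exists>u \<in> arr C A Y. \<exists>v \<in> arr C Y B. f = v \<cdot>\<^bsub>C\<^esub> u}"

text \<open>
  \<open>mor_class C X f\<close> is the coset \<open>factoring C X A B + f\<close>, where \<open>A\<close> and \<open>B\<close> are the
  domain and codomain determined by \<open>f\<close>.
\<close>

definition mor_class :: "('o, 'm, 'z) cat_data_scheme \<Rightarrow> 'o set \<Rightarrow> 'm \<Rightarrow> 'm set" where
  "mor_class C X f = {h. \<exists>A B. f \<in> arr C A B \<and> h \<in> factoring C X A B #>\<^bsub>Hom C A B\<^esub> f}"

text \<open>
  Composites in the quotient are defined from representatives. All representatives give the
  same class, so the union over them is that class.
\<close>

definition quotient_category ::
  "('o, 'm, 'z) cat_data_scheme \<Rightarrow> 'o set \<Rightarrow> ('o, 'm set) cat_data" where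
  "quotient_category C X = \<lparr>
     Obj = Obj C,
     Hom = (\<lambda>A B. Hom C A B Mod factoring C X A B),
     Cmp = (\<lambda>\<psi> \<phi>. \<Union>g \<in> \<psi>. \<Union>f \<in> \<phi>. mor_class C X (g \<cdot>\<^bsub>C\<^esub> f)),
     Idn = (\<lambda>A. mor_class C X (Idn C A))\<rparr>"

text \<open>
  A choice, for each \<open>A\<close>, of an \<open>\<bbbE>\<close>-triangle
  \<open>A \<rightarrow> chMid A \<rightarrow> A\<langle>1\<rangle>\<close> with morphisms \<open>chIn A\<close>, \<open>chOut A\<close>, realizing \<open>chExt A\<close>,
  where \<open>A\<langle>1\<rangle> = chShift A\<close>.
\<close>

record ('o, 'm, 'e) shift_choice =
  chIn :: "'o \<Rightarrow> 'm"
  chMid :: "'o \<Rightarrow> 'o"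
  chOut :: "'o \<Rightarrow> 'm"
  chShift :: "'o \<Rightarrow> 'o"
  chExt :: "'o \<Rightarrow> 'e"

definition valid_shift_choice ::
  "('o, 'm, 'e, 'z) ext_data_scheme \<Rightarrow> 'o set \<Rightarrow> 'o set \<Rightarrow> ('o, 'm, 'e) shift_choice \<Rightarrow> bool" where
  "valid_shift_choice S \<A> X c \<longleftrightarrow> (\<forall>A \<in> \<A>.
     chShift c A \<in> \<A> \<and>
     etriangle S A (chIn c A) (chMid c A) (chOut c A) (chShift c A) (chExt c A) \<and>
     left_approx S X A (chMid c A) (chIn c A) \<and>
     right_approx S X (chMid c A) (chShift c A) (chOut c A))"

definition chosen_etriangle_morphism ::
  "('o, 'm, 'e, 'z) ext_data_scheme \<Rightarrow> ('o, 'm, 'e) shift_choice \<Rightarrow>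
   'o \<Rightarrow> 'm \<Rightarrow> 'o \<Rightarrow> 'm \<Rightarrow> 'o \<Rightarrow> 'e \<Rightarrow> 'o \<Rightarrow> 'm \<Rightarrow> 'm \<Rightarrow> bool" where
  "chosen_etriangle_morphism S c A x B y Z \<delta> A' a h \<longleftrightarrow>
     (\<exists>b. etriangle_morphism S A x B y Z \<delta>
            A' (chIn c A') (chMid c A') (chOut c A') (chShift c A') (chExt c A') a b h)"

text \<open>
  On morphisms the shift sends the class of \<open>f : A \<rightarrow> B\<close> to the class of any \<open>g\<close> occurring in a
  morphism of \<open>\<bbbE>\<close>-triangles \<open>(f, *, g)\<close> between the chosen \<open>\<bbbE>\<close>-triangles; as for composition,
  the result is given as a union over all choices, which all yield the same class.
\<close>

definition quotient_shift ::
  "('o, 'm, 'e, 'z) ext_data_scheme \<Rightarrow> 'o set \<Rightarrow> 'o set \<Rightarrow> ('o, 'm, 'e) shift_choice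
   \<Rightarrow> 'm set \<Rightarrow> 'm set" where
  "quotient_shift S \<A> X c \<phi> =
     \<Union>{mor_class (full_subcategory S \<A>) X g | f g A B.
         f \<in> \<phi> \<and> A \<in> \<A> \<and> B \<in> \<A> \<and> f \<in> arr S A B \<and>
         chosen_etriangle_morphism S c
           A (chIn c A) (chMid c A) (chOut c A) (chShift c A) (chExt c A) B f g}"

definition standard_triangle ::
  "('o, 'm, 'e, 'z) ext_data_scheme \<Rightarrow> 'o set \<Rightarrow> 'o set \<Rightarrow> ('o, 'm, 'e) shift_choice
   \<Rightarrow> 'o \<Rightarrow> 'm \<Rightarrow> 'o \<Rightarrow> 'm \<Rightarrow> 'o \<Rightarrow> 'm \<Rightarrow> bool" where
  "standard_triangle S \<A> X c A f B g Z h \<longleftrightarrow> A \<in> \<A> \<and> B \<in> \<A> \<and> Z \<in> \<A> \<and>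
     (\<forall>Y \<in> X. \<forall>u \<in> arr S A Y. \<exists>v \<in> arr S B Y. u = v \<cdot>\<^bsub>S\<^esub> f) \<and>
     (\<exists>\<delta>. etriangle S A f B g Z \<delta> \<and>
          chosen_etriangle_morphism S c A f B g Z \<delta> A (Idn S A) h)"

definition quotient_triangle ::
  "('o, 'm, 'e, 'z) ext_data_scheme \<Rightarrow> 'o set \<Rightarrow> 'o set \<Rightarrow> ('o, 'm, 'e) shift_choice
   \<Rightarrow> 'o \<Rightarrow> 'm set \<Rightarrow> 'o \<Rightarrow> 'm set \<Rightarrow> 'o \<Rightarrow> 'm set \<Rightarrow> bool" where
  "quotient_triangle S \<A> X c A' \<phi> B' \<psi> Z' \<theta> \<longleftrightarrow>
     (let M = quotient_category (full_subcategory S \<A>) X;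
          cl = mor_class (full_subcategory S \<A>) X
      in \<phi> \<in> arr M A' B' \<and> \<psi> \<in> arr M B' Z' \<and> \<theta> \<in> arr M Z' (chShift c A') \<and>
         (\<exists>A f B g Z h \<alpha> \<beta> \<gamma>. standard_triangle S \<A> X c A f B g Z h \<and>
            is_iso M A' A \<alpha> \<and> is_iso M B' B \<beta> \<and> is_iso M Z' Z \<gamma> \<and>
            cl f \<cdot>\<^bsub>M\<^esub> \<alpha> = \<beta> \<cdot>\<^bsub>M\<^esub> \<phi> \<and>
            cl g \<cdot>\<^bsub>M\<^esub> \<beta> = \<gamma> \<cdot>\<^bsub>M\<^esub> \<psi> \<and>
            cl h \<cdot>\<^bsub>M\<^esub> \<gamma> = quotient_shift S \<A> X c \<alpha> \<cdot>\<^bsub>M\<^esub> \<theta>))"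

definition triangulated_quotient ::
  "('o, 'm, 'e, 'z) ext_data_scheme \<Rightarrow> 'o set \<Rightarrow> 'o set \<Rightarrow> ('o, 'm, 'e) shift_choice
   \<Rightarrow> ('o, 'm set) tri_data" where
  "triangulated_quotient S \<A> X c =
     (let M = quotient_category (full_subcategory S \<A>) X
      in \<lparr>Obj = Obj M, Hom = Hom M, Cmp = Cmp M, Idn = Idn M,
          Shift = chShift c, ShiftM = quotient_shift S \<A> X c,
          Tri = quotient_triangle S \<A> X c\<rparr>)"

end

theory Submission
  imports Defs
begin

text \<open>
  For \<open>Z, A\<close> in \<open>\<A>\<close>, pulling back the chosen \<open>\<bbbE>\<close>-triangle \<open>A \<rightarrow> Y \<rightarrow> A\<langle>1\<rangle>\<close> with \<open>Y \<in> X\<close> identifies the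
  morphisms \<open>Z \<rightarrow> A\<langle>1\<rangle>\<close> modulo \<open>X\<close> with \<open>\<bbbE>(Z, A)\<close>: every extension of \<open>Z\<close> by \<open>A\<close> is such a pullback
  because \<open>\<bbbE>(Z, Y) = 0\<close>, and a morphism that pulls the \<open>\<bbbE>\<close>-triangle back to zero lifts to \<open>Y\<close>. So
  \<open>Hom(U, V\<langle>1\<rangle>)\<close> vanishes in the quotient if and only if \<open>\<bbbE>(U, V)\<close> does
  (\<open>shift_hom_trivial_iff\<close>), and an \<open>\<bbbE>\<close>-triangle with all terms in \<open>\<A>\<close> gives a triangle
  (\<open>conflation_triangle\<close>).

  If \<open>(U, V)\<close> is a cotorsion pair of the extriangulated category, then \<open>U\<close> and \<open>V\<close> are orthogonal complements of each other, so
  \<open>X \<subseteq> V \<subseteq> \<A>\<close>, and the approximating \<open>\<bbbE>\<close>-triangles of objects of \<open>\<A>\<close> lie in \<open>\<A>\<close>. Moreover \<open>\<bbbE>(-, V)\<close>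
  and \<open>\<bbbE>(U, -)\<close> vanish on \<open>X\<close>, whence both classes are closed under isomorphisms, sums and summands
  modulo \<open>X\<close>.

  Conversely, a triangle of the quotient comes from an \<open>\<bbbE>\<close>-triangle \<open>A \<rightarrow> B \<rightarrow> Z\<close> with \<open>A \<in> V\<close> and
  \<open>B \<in> U\<close>, but \<open>Z\<close> is isomorphic to the given object \<open>C\<close> only modulo \<open>X\<close>. The lemma
  \<open>conflation_transfer\<close> replaces \<open>Z\<close> by \<open>C\<close>, and \<open>precover_extend\<close> passes from objects of \<open>\<A>\<close> to all
  objects. The \<open>\<bbbE>\<close>-triangles of the other kind are obtained by applying this to the opposite category.

  An \<open>\<bbbE>\<close>-triangle is also called a conflation; its two morphisms are an inflation and a deflation.
\<close>

section \<open>Additive categories\<close>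

lemma arrD:
  assumes "f \<in> arr C A B"
  shows "A \<in> Obj C" "B \<in> Obj C" "f \<in> carrier (Hom C A B)"
  using assms by (auto simp: arr_def)

lemma biproductD:
  assumes "biproduct C A B T i j p q"
  shows "i \<in> arr C A T" "j \<in> arr C B T" "p \<in> arr C T A" "q \<in> arr C T B"
    "p \<cdot>\<^bsub>C\<^esub> i = Idn C A" "q \<cdot>\<^bsub>C\<^esub> j = Idn C B"
    "q \<cdot>\<^bsub>C\<^esub> i = \<one>\<^bsub>Hom C A B\<^esub>" "p \<cdot>\<^bsub>C\<^esub> j = \<one>\<^bsub>Hom C B A\<^esub>"
    "(i \<cdot>\<^bsub>C\<^esub> p) \<otimes>\<^bsub>Hom C T T\<^esub> (j \<cdot>\<^bsub>C\<^esub> q) = Idn C T"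
  using assms unfolding biproduct_def by auto

context additive_category
begin

lemma null_arr: "\<lbrakk>A \<in> Obj C; B \<in> Obj C\<rbrakk> \<Longrightarrow> \<one>\<^bsub>Hom C A B\<^esub> \<in> arr C A B"
  using hom_group[of A B] by (simp add: arr_def comm_group_def group.is_monoid)

lemma add_arr: "\<lbrakk>f \<in> arr C A B; g \<in> arr C A B\<rbrakk> \<Longrightarrow> f \<otimes>\<^bsub>Hom C A B\<^esub> g \<in> arr C A B"
  using hom_group[of A B] by (auto simp: arr_def comm_group_def group.is_monoid monoid.m_closed)

lemma neg_arr: "f \<in> arr C A B \<Longrightarrow> inv\<^bsub>Hom C A B\<^esub> f \<in> arr C A B"
  using hom_group[of A B] by (auto simp: arr_def comm_group_def)

lemma add_comm:
  "\<lbrakk>f \<in> arr C A B; g \<in> arr C A B\<rbrakk> \<Longrightarrow> f \<otimes>\<^bsub>Hom C A B\<^esub> g = g \<otimes>\<^bsub>Hom C A B\<^esub> f"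
  using hom_group[of A B] by (simp add: arr_def comm_group_def comm_monoid.m_comm)

lemma add_null_left: "f \<in> arr C A B \<Longrightarrow> \<one>\<^bsub>Hom C A B\<^esub> \<otimes>\<^bsub>Hom C A B\<^esub> f = f"
  using hom_group[of A B] by (auto simp: arr_def comm_group_def group.is_monoid)

lemma add_null_right: "f \<in> arr C A B \<Longrightarrow> f \<otimes>\<^bsub>Hom C A B\<^esub> \<one>\<^bsub>Hom C A B\<^esub> = f"
  using hom_group[of A B] by (auto simp: arr_def comm_group_def group.is_monoid)

lemma add_neg: "f \<in> arr C A B \<Longrightarrow> f \<otimes>\<^bsub>Hom C A B\<^esub> inv\<^bsub>Hom C A B\<^esub> f = \<one>\<^bsub>Hom C A B\<^esub>"
  using hom_group[of A B] by (auto simp: arr_def comm_group_def group.r_inv)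

lemma comp_add:
  "\<lbrakk>f \<in> arr C A B; g \<in> arr C B D; g' \<in> arr C B D\<rbrakk>
    \<Longrightarrow> (g \<otimes>\<^bsub>Hom C B D\<^esub> g') \<cdot> f = (g \<cdot> f) \<otimes>\<^bsub>Hom C A D\<^esub> (g' \<cdot> f)"
  using comp_add_left[of f A B D] by (auto simp: hom_def arr_def)

lemma add_comp:
  "\<lbrakk>f \<in> arr C A B; f' \<in> arr C A B; g \<in> arr C B D\<rbrakk>
    \<Longrightarrow> g \<cdot> (f \<otimes>\<^bsub>Hom C A B\<^esub> f') = (g \<cdot> f) \<otimes>\<^bsub>Hom C A D\<^esub> (g \<cdot> f')"
  using comp_add_right[of g B D A] by (auto simp: hom_def arr_def)

lemma comp_null_left:
  assumes "f \<in> arr C A B" "D \<in> Obj C"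
  shows "\<one>\<^bsub>Hom C B D\<^esub> \<cdot> f = \<one>\<^bsub>Hom C A D\<^esub>"
  using hom_one[OF comp_add_left[OF assms]] hom_group arrD[OF assms(1)] assms(2)
  by (simp add: comm_group_def)

lemma comp_null_right:
  assumes "g \<in> arr C B D" "A \<in> Obj C"
  shows "g \<cdot> \<one>\<^bsub>Hom C A B\<^esub> = \<one>\<^bsub>Hom C A D\<^esub>"
  using hom_one[OF comp_add_right[OF assms]] hom_group arrD[OF assms(1)] assms(2)
  by (simp add: comm_group_def)

lemma comp_neg:
  assumes "f \<in> arr C A B" "g \<in> arr C B D"
  shows "g \<cdot> inv\<^bsub>Hom C A B\<^esub> f = inv\<^bsub>Hom C A D\<^esub> (g \<cdot> f)"
  using assms hom_group arrD[OF assms(1)] arrD[OF assms(2)]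
    group_hom.hom_inv[of "Hom C A B" "Hom C A D" "\<lambda>f. g \<cdot> f" f] comp_add_right[of g B D A]
  by (simp add: comm_group_def group_hom_def group_hom_axioms_def)

lemma zero_object_arr_unique:
  assumes "zero_object C Z"
  shows "\<lbrakk>f \<in> arr C A Z; g \<in> arr C A Z\<rbrakk> \<Longrightarrow> f = g" "\<lbrakk>f \<in> arr C Z A; g \<in> arr C Z A\<rbrakk> \<Longrightarrow> f = g"
  using assms unfolding zero_object_def by (blast dest: arrD)+

lemma biproduct_swap:
  assumes "biproduct C A B T i j p q"
  shows "biproduct C B A T j i q p"
  using assms unfolding biproduct_def by (metis add_comm comp_arr)

lemma biproduct_copair:
  assumes b: "biproduct C A B T i j p q" and f: "f \<in> arr C A D" and g: "g \<in> arr C B D"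
  defines "h \<equiv> (f \<cdot> p) \<otimes>\<^bsub>Hom C T D\<^esub> (g \<cdot> q)"
  shows "h \<in> arr C T D" "h \<cdot> i = f" "h \<cdot> j = g"
proof -
  note B = biproductD[OF b]
  have fp: "f \<cdot> p \<in> arr C T D" and gq: "g \<cdot> q \<in> arr C T D"
    using comp_arr[OF B(3) f] comp_arr[OF B(4) g] .
  show "h \<in> arr C T D"
    using add_arr[OF fp gq] by (simp add: h_def)
  have "h \<cdot> i = (f \<cdot> (p \<cdot> i)) \<otimes>\<^bsub>Hom C A D\<^esub> (g \<cdot> (q \<cdot> i))"
    unfolding h_def using comp_add[OF B(1) fp gq] comp_assoc[OF B(1) B(3) f] comp_assoc[OF B(1) B(4) g]
    by simp
  also have "\<dots> = f"
    using B(5,7) id_right[OF f] comp_null_right[OF g] arrD[OF f] add_null_right[OF f] by simp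
  finally show "h \<cdot> i = f" .
  have "h \<cdot> j = (f \<cdot> (p \<cdot> j)) \<otimes>\<^bsub>Hom C B D\<^esub> (g \<cdot> (q \<cdot> j))"
    unfolding h_def using comp_add[OF B(2) fp gq] comp_assoc[OF B(2) B(3) f] comp_assoc[OF B(2) B(4) g]
    by simp
  also have "\<dots> = g"
    using B(6,8) id_right[OF g] comp_null_right[OF f] arrD[OF g] add_null_left[OF g] by simp
  finally show "h \<cdot> j = g" .
qed

lemma biproduct_eqI:
  assumes b: "biproduct C A B T i j p q" and f: "f \<in> arr C T D" and g: "g \<in> arr C T D"
    and "f \<cdot> i = g \<cdot> i" "f \<cdot> j = g \<cdot> j"
  shows "f = g"
proof -
  note B = biproductD[OF b]
  have expand: "h = ((h \<cdot> i) \<cdot> p) \<otimes>\<^bsub>Hom C T D\<^esub> ((h \<cdot> j) \<cdot> q)" if h: "h \<in> arr C T D" for h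
    using add_comp[OF comp_arr[OF B(3,1)] comp_arr[OF B(4,2)] h] B(9) id_right[OF h]
      comp_assoc[OF B(3,1) h] comp_assoc[OF B(4,2) h] by simp
  show ?thesis
    using expand[OF f] expand[OF g] assms(4,5) by simp
qed

lemma biproduct_zero_object:
  assumes N: "zero_object C N" and A: "A \<in> Obj C"
  shows "biproduct C A N A (Idn C A) \<one>\<^bsub>Hom C N A\<^esub> (Idn C A) \<one>\<^bsub>Hom C A N\<^esub>"
proof -
  have "N \<in> Obj C"
    using N unfolding zero_object_def by blast
  note n = null_arr[OF \<open>N \<in> Obj C\<close> A] null_arr[OF A \<open>N \<in> Obj C\<close>]
  show ?thesis
    unfolding biproduct_def
    using n id_arr[OF \<open>N \<in> Obj C\<close>] id_arr[OF A] id_left[OF n(1)] id_right[OF n(2)]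
      id_left[OF id_arr[OF A]] zero_object_arr_unique(2)[OF N comp_arr[OF n] id_arr[OF \<open>N \<in> Obj C\<close>]]
      comp_null_left[OF n(2) A] add_null_right[OF id_arr[OF A]] by simp
qed

text \<open>Direct sums are stable under isomorphisms of the sum.\<close>

lemma biproduct_transport:
  assumes b: "biproduct C A B T i j p q" and h: "h \<in> arr C T' T" and k: "k \<in> arr C T T'"
    and hk: "h \<cdot> k = Idn C T" and kh: "k \<cdot> h = Idn C T'"
  shows "biproduct C A B T' (k \<cdot> i) (k \<cdot> j) (p \<cdot> h) (q \<cdot> h)"
proof -
  note B = biproductD[OF b]
  have cancel: "(r \<cdot> h) \<cdot> (k \<cdot> s) = r \<cdot> s" if "r \<in> arr C T D" "s \<in> arr C D' T" for r s D D'
    using that comp_assoc[OF comp_arr[OF that(2) k] h that(1)] comp_assoc[OF that(2) k h] hk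
      id_left[OF that(2)] by simp
  have conj: "(k \<cdot> s) \<cdot> (r \<cdot> h) = k \<cdot> ((s \<cdot> r) \<cdot> h)" if "s \<in> arr C D T" "r \<in> arr C T D" for r s D
    using that comp_assoc[OF comp_arr[OF h that(2)] that(1) k] comp_assoc[OF h that(2) that(1)] by simp
  have ip: "i \<cdot> p \<in> arr C T T" and jq: "j \<cdot> q \<in> arr C T T"
    using comp_arr[OF B(3,1)] comp_arr[OF B(4,2)] .
  have "((k \<cdot> i) \<cdot> (p \<cdot> h)) \<otimes>\<^bsub>Hom C T' T'\<^esub> ((k \<cdot> j) \<cdot> (q \<cdot> h))
      = k \<cdot> (((i \<cdot> p) \<otimes>\<^bsub>Hom C T T\<^esub> (j \<cdot> q)) \<cdot> h)"
    using conj[OF B(1,3)] conj[OF B(2,4)] comp_add[OF h ip jq]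
      add_comp[OF comp_arr[OF h ip] comp_arr[OF h jq] k] by simp
  also have "\<dots> = Idn C T'"
    using B(9) id_left[OF h] kh by simp
  finally show ?thesis
    unfolding biproduct_def
    using cancel[OF B(3,1)] cancel[OF B(4,2)] cancel[OF B(4,1)] cancel[OF B(3,2)] B comp_arr h k
    by auto
qed

end


section \<open>Congruence modulo a subcategory\<close>

text \<open>
  The morphisms \<open>f, g : A \<rightarrow> B\<close> have the same class modulo \<open>X\<close>, that is, they differ by a
  morphism factoring through an object of \<open>X\<close>.
\<close>

definition cong_mod ::
  "('o, 'm, 'z) cat_data_scheme \<Rightarrow> 'o set \<Rightarrow> 'o \<Rightarrow> 'o \<Rightarrow> 'm \<Rightarrow> 'm \<Rightarrow> bool" where
  "cong_mod C X A B f g \<longleftrightarrow> f \<in> arr C A B \<and> g \<in> arr C A B \<and>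
     (\<exists>k \<in> factoring C X A B. f = k \<otimes>\<^bsub>Hom C A B\<^esub> g)"

lemma cong_modD: "cong_mod C X A B f g \<Longrightarrow> f \<in> arr C A B" "cong_mod C X A B f g \<Longrightarrow> g \<in> arr C A B"
  by (auto simp: cong_mod_def)

lemma factoring_arr: "k \<in> factoring C X A B \<Longrightarrow> k \<in> arr C A B"
  by (simp add: factoring_def)

lemma factoringE:
  assumes "k \<in> factoring C X A B"
  obtains Y u v where "Y \<in> X" "u \<in> arr C A Y" "v \<in> arr C Y B" "k = v \<cdot>\<^bsub>C\<^esub> u"
  using assms by (auto simp: factoring_def)

lemma (in additive_category) factoringI:
  "\<lbrakk>Y \<in> X; u \<in> arr C A Y; v \<in> arr C Y B\<rbrakk> \<Longrightarrow> v \<cdot> u \<in> factoring C X A B"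
  using comp_arr by (auto simp: factoring_def)

lemma (in additive_category) comp_factoring:
  assumes "k \<in> factoring C X A B" "g \<in> arr C B D"
  shows "g \<cdot> k \<in> factoring C X A D"
  using assms(1)
proof (rule factoringE)
  fix Y u v assume *: "Y \<in> X" "u \<in> arr C A Y" "v \<in> arr C Y B" "k = v \<cdot> u"
  show ?thesis
    using factoringI[OF *(1,2) comp_arr[OF *(3) assms(2)]] comp_assoc[OF *(2,3) assms(2)] *(4) by simp
qed

lemma (in additive_category) factoring_comp:
  assumes "k \<in> factoring C X B D" "f \<in> arr C A B"
  shows "k \<cdot> f \<in> factoring C X A D"
  using assms(1)
proof (rule factoringE)
  fix Y u v assume *: "Y \<in> X" "u \<in> arr C B Y" "v \<in> arr C Y D" "k = v \<cdot> u"
  show ?thesis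
    using factoringI[OF *(1) comp_arr[OF assms(2) *(2)] *(3)] comp_assoc[OF assms(2) *(2,3)] *(4) by simp
qed

lemma subcategoryD:
  assumes "subcategory C B"
  shows "B \<subseteq> Obj C" "\<lbrakk>A \<in> B; is_iso C A A' f\<rbrakk> \<Longrightarrow> A' \<in> B" "zero_object C Z \<Longrightarrow> Z \<in> B"
    "\<lbrakk>A \<in> B; A' \<in> B; direct_sum C A A' D\<rbrakk> \<Longrightarrow> D \<in> B"
    "\<lbrakk>D \<in> B; direct_sum C A A' D\<rbrakk> \<Longrightarrow> A \<in> B" "\<lbrakk>D \<in> B; direct_sum C A A' D\<rbrakk> \<Longrightarrow> A' \<in> B"
  using assms unfolding subcategory_def by metis+

locale additive_category_with_subcategory = additive_category C
  for C :: "('o, 'm, 'z) cat_data_scheme" (structure) +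
  fixes X :: "'o set"
  assumes subcat: "subcategory C X"
begin

lemma subcat_obj: "Y \<in> X \<Longrightarrow> Y \<in> Obj C"
  using subcategoryD(1)[OF subcat] by blast

lemma subcat_sum: "\<lbrakk>Y \<in> X; Y' \<in> X; direct_sum C Y Y' T\<rbrakk> \<Longrightarrow> T \<in> X"
  using subcategoryD(4)[OF subcat] .

lemma subcat_zero: "zero_object C Z \<Longrightarrow> Z \<in> X"
  using subcategoryD(3)[OF subcat] .

lemma null_factoring:
  assumes "A \<in> Obj C" "B \<in> Obj C"
  shows "\<one>\<^bsub>Hom C A B\<^esub> \<in> factoring C X A B"
proof -
  obtain Z where Z: "zero_object C Z"
    using has_zero_object by blast
  then have "Z \<in> Obj C"
    by (rule subcat_obj[OF subcat_zero])
  show ?thesis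
    using factoringI[OF subcat_zero[OF Z] null_arr null_arr, OF assms(1) \<open>Z \<in> Obj C\<close> _ assms(2)]
      comp_null_left[OF null_arr[OF assms(1) \<open>Z \<in> Obj C\<close>] assms(2)] \<open>Z \<in> Obj C\<close> by metis
qed

lemma factoring_add:
  assumes "k \<in> factoring C X A B" "k' \<in> factoring C X A B"
  shows "k \<otimes>\<^bsub>Hom C A B\<^esub> k' \<in> factoring C X A B"
proof -
  obtain Y u v where k: "Y \<in> X" "u \<in> arr C A Y" "v \<in> arr C Y B" "k = v \<cdot> u"
    using assms(1) by (rule factoringE)
  obtain Y' u' v' where k': "Y' \<in> X" "u' \<in> arr C A Y'" "v' \<in> arr C Y' B" "k' = v' \<cdot> u'"
    using assms(2) by (rule factoringE)
  obtain T i j p q where b: "biproduct C Y Y' T i j p q"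
    using has_direct_sums[OF subcat_obj[OF k(1)] subcat_obj[OF k'(1)]] by (auto simp: direct_sum_def)
  note B = biproductD[OF b]
  have "T \<in> X"
    using subcat_sum[OF k(1) k'(1), unfolded direct_sum_def] b by blast
  define w where "w = (i \<cdot> u) \<otimes>\<^bsub>Hom C A T\<^esub> (j \<cdot> u')"
  define h where "h = (v \<cdot> p) \<otimes>\<^bsub>Hom C T B\<^esub> (v' \<cdot> q)"
  note H = biproduct_copair[OF b k(3) k'(3), folded h_def]
  have iu: "i \<cdot> u \<in> arr C A T" and ju: "j \<cdot> u' \<in> arr C A T"
    using comp_arr[OF k(2) B(1)] comp_arr[OF k'(2) B(2)] .
  have "h \<cdot> w = k \<otimes>\<^bsub>Hom C A B\<^esub> k'"
    unfolding w_def using add_comp[OF iu ju H(1)] comp_assoc[OF k(2) B(1) H(1)]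
      comp_assoc[OF k'(2) B(2) H(1)] H(2,3) k(4) k'(4) by simp
  moreover have "h \<cdot> w \<in> factoring C X A B"
    using factoringI[OF \<open>T \<in> X\<close> _ H(1)] add_arr[OF iu ju] by (simp add: w_def)
  ultimately show ?thesis by simp
qed

lemma factoring_neg:
  assumes "k \<in> factoring C X A B"
  shows "inv\<^bsub>Hom C A B\<^esub> k \<in> factoring C X A B"
  using assms
proof (rule factoringE)
  fix Y u v assume k: "Y \<in> X" "u \<in> arr C A Y" "v \<in> arr C Y B" "k = v \<cdot> u"
  show ?thesis
    using factoringI[OF k(1) neg_arr[OF k(2)] k(3)] comp_neg[OF k(2,3)] k(4) by simp
qed

lemma factoring_subgroup:
  assumes "A \<in> Obj C" "B \<in> Obj C"
  shows "subgroup (factoring C X A B) (Hom C A B)"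
  using hom_group[OF assms] null_factoring[OF assms] factoring_add factoring_neg arrD(3)[OF factoring_arr]
  by (auto intro!: group.subgroupI simp: comm_group_def)

lemma cong_iff_coset:
  assumes "f \<in> arr C A B" "g \<in> arr C A B"
  shows "cong_mod C X A B f g \<longleftrightarrow> f \<in> factoring C X A B #>\<^bsub>Hom C A B\<^esub> g"
  using assms by (auto simp: cong_mod_def r_coset_def)

lemma cong_iff_coset_eq:
  assumes "f \<in> arr C A B" "g \<in> arr C A B"
  shows "cong_mod C X A B f g \<longleftrightarrow>
    factoring C X A B #>\<^bsub>Hom C A B\<^esub> f = factoring C X A B #>\<^bsub>Hom C A B\<^esub> g"
proof -
  have G: "group (Hom C A B)"
    using hom_group[OF arrD(1,2)[OF assms(1)]] by (simp add: comm_group_def)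
  show ?thesis
    unfolding cong_iff_coset[OF assms]
    using group.repr_independence[OF G _ arrD(3)[OF assms(2)] factoring_subgroup]
      group.rcos_self[OF G arrD(3)[OF assms(1)] factoring_subgroup] arrD[OF assms(1)] by blast
qed

lemma cong_refl: "f \<in> arr C A B \<Longrightarrow> cong_mod C X A B f f"
  by (simp add: cong_iff_coset_eq)

lemma cong_sym: "cong_mod C X A B f g \<Longrightarrow> cong_mod C X A B g f"
  using cong_iff_coset_eq cong_modD by metis

lemma cong_trans: "\<lbrakk>cong_mod C X A B f g; cong_mod C X A B g h\<rbrakk> \<Longrightarrow> cong_mod C X A B f h"
  using cong_iff_coset_eq cong_modD by metis

lemma cong_comp_left:
  assumes "cong_mod C X A B f f'" "g \<in> arr C B D"
  shows "cong_mod C X A D (g \<cdot> f) (g \<cdot> f')"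
proof -
  obtain k where k: "k \<in> factoring C X A B" "f = k \<otimes>\<^bsub>Hom C A B\<^esub> f'"
    using assms(1) by (auto simp: cong_mod_def)
  have "g \<cdot> f = (g \<cdot> k) \<otimes>\<^bsub>Hom C A D\<^esub> (g \<cdot> f')"
    using add_comp[OF factoring_arr[OF k(1)] cong_modD(2)[OF assms(1)] assms(2)] k(2) by simp
  then show ?thesis
    unfolding cong_mod_def using comp_factoring[OF k(1) assms(2)]
      comp_arr[OF cong_modD(1)[OF assms(1)] assms(2)] comp_arr[OF cong_modD(2)[OF assms(1)] assms(2)]
    by blast
qed

lemma cong_comp_right:
  assumes "cong_mod C X B D g g'" "f \<in> arr C A B"
  shows "cong_mod C X A D (g \<cdot> f) (g' \<cdot> f)"
proof -
  obtain k where k: "k \<in> factoring C X B D" "g = k \<otimes>\<^bsub>Hom C B D\<^esub> g'"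
    using assms(1) by (auto simp: cong_mod_def)
  have "g \<cdot> f = (k \<cdot> f) \<otimes>\<^bsub>Hom C A D\<^esub> (g' \<cdot> f)"
    using comp_add[OF assms(2) factoring_arr[OF k(1)] cong_modD(2)[OF assms(1)]] k(2) by simp
  then show ?thesis
    unfolding cong_mod_def using factoring_comp[OF k(1) assms(2)]
      comp_arr[OF assms(2) cong_modD(1)[OF assms(1)]] comp_arr[OF assms(2) cong_modD(2)[OF assms(1)]]
    by blast
qed

lemma cong_comp:
  assumes "cong_mod C X A B f f'" "cong_mod C X B D g g'"
  shows "cong_mod C X A D (g \<cdot> f) (g' \<cdot> f')"
  using cong_trans[OF cong_comp_left[OF assms(1) cong_modD(1)[OF assms(2)]]
      cong_comp_right[OF assms(2) cong_modD(2)[OF assms(1)]]] .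

lemma cong_null_iff:
  assumes "f \<in> arr C A B"
  shows "cong_mod C X A B f \<one>\<^bsub>Hom C A B\<^esub> \<longleftrightarrow> f \<in> factoring C X A B"
proof -
  have "f \<in> factoring C X A B \<longleftrightarrow> (\<exists>k \<in> factoring C X A B. f = k \<otimes>\<^bsub>Hom C A B\<^esub> \<one>\<^bsub>Hom C A B\<^esub>)"
    using add_null_right factoring_arr by (metis (no_types, lifting))
  then show ?thesis
    using assms null_arr arrD[OF assms] by (auto simp: cong_mod_def)
qed

end

section \<open>The opposite extriangulated category\<close>

text \<open>
  Reversing all morphisms exchanges the two ends of an extension. The axioms are self-dual, so
  every statement about extriangulated categories may be applied to the opposite one.
\<close>

definition op_ext :: "('o, 'm, 'e, 'z) ext_data_scheme \<Rightarrow> ('o, 'm, 'e) ext_data" where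
  "op_ext S = \<lparr>
     Obj = Obj S, Hom = (\<lambda>A B. Hom S B A), Cmp = (\<lambda>g f. f \<cdot>\<^bsub>S\<^esub> g), Idn = Idn S,
     Ext = (\<lambda>Z A. Ext S A Z),
     Push = (\<lambda>Z a \<delta>. Pull S a Z \<delta>),
     Pull = (\<lambda>c A \<delta>. Push S A c \<delta>),
     Real = (\<lambda>Z A \<delta>. {(B, x, y). (B, y, x) \<in> Real S A Z \<delta>})\<rparr>"

lemma op_ext_simps [simp]:
  "Obj (op_ext S) = Obj S" "Hom (op_ext S) A B = Hom S B A" "g \<cdot>\<^bsub>op_ext S\<^esub> f = f \<cdot>\<^bsub>S\<^esub> g"
  "Idn (op_ext S) = Idn S" "Ext (op_ext S) Z A = Ext S A Z" "Push (op_ext S) Z a \<delta> = Pull S a Z \<delta>"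
  "Pull (op_ext S) a Z \<delta> = Push S Z a \<delta>"
  "(B, x, y) \<in> Real (op_ext S) Z A \<delta> \<longleftrightarrow> (B, y, x) \<in> Real S A Z \<delta>"
  by (auto simp: op_ext_def)

lemma arr_op [simp]: "arr (op_ext S) A B = arr S B A"
  by (auto simp: arr_def)

lemma exts_op [simp]: "exts (op_ext S) A Z = exts S Z A"
  by (auto simp: exts_def)

lemma etriangle_op [simp]: "etriangle (op_ext S) A x B y Z \<delta> \<longleftrightarrow> etriangle S Z y B x A \<delta>"
  by (simp add: etriangle_def)

lemma ext_morphism_op [simp]:
  "ext_morphism (op_ext S) A Z \<delta> A' Z' \<delta>' a c \<longleftrightarrow> ext_morphism S Z' A' \<delta>' Z A \<delta> c a"
  by (auto simp: ext_morphism_def)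

lemma is_iso_op [simp]: "is_iso (op_ext S) A B f \<longleftrightarrow> is_iso S B A f"
  by (auto simp: is_iso_def)

lemma zero_object_op [simp]: "zero_object (op_ext S) Z \<longleftrightarrow> zero_object S Z"
  by (auto simp: zero_object_def)

lemma biproduct_op [simp]: "biproduct (op_ext S) A B T i j p q \<longleftrightarrow> biproduct S A B T p q i j"
  by (auto simp: biproduct_def)

lemma direct_sum_op [simp]: "direct_sum (op_ext S) A B T \<longleftrightarrow> direct_sum S A B T"
  by (auto simp: direct_sum_def)

lemma factoring_op [simp]: "factoring (op_ext S) X A B = factoring S X B A"
  by (auto simp: factoring_def)

lemma cong_mod_op [simp]: "cong_mod (op_ext S) X A B f g \<longleftrightarrow> cong_mod S X B A f g"
  by (auto simp: cong_mod_def)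

lemma ext_vanishes_op [simp]: "ext_vanishes (op_ext S) U V \<longleftrightarrow> ext_vanishes S V U"
  by (auto simp: ext_vanishes_def)

lemma perp_op [simp]:
  "right_perp (op_ext S) X = left_perp S X" "left_perp (op_ext S) X = right_perp S X"
  by (auto simp: right_perp_def left_perp_def)

lemma approx_op [simp]:
  "left_approx (op_ext S) X A Y f \<longleftrightarrow> right_approx S X Y A f"
  "right_approx (op_ext S) X Y A f \<longleftrightarrow> left_approx S X A Y f"
  by (auto simp: left_approx_def right_approx_def)

lemma projective_objects_op [simp]: "projective_objects (op_ext S) = injective_objects S"
  unfolding projective_objects_def injective_objects_def etriangle_op arr_op op_ext_simps by blast

lemma injective_objects_op [simp]: "injective_objects (op_ext S) = projective_objects S"
  unfolding projective_objects_def injective_objects_def etriangle_op arr_op op_ext_simps by blast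

lemma enough_injectives_op [simp]: "enough_injectives (op_ext S) \<longleftrightarrow> enough_projectives S"
  unfolding enough_projectives_def enough_injectives_def injective_objects_op etriangle_op op_ext_simps by blast

lemma enough_projectives_op [simp]: "enough_projectives (op_ext S) \<longleftrightarrow> enough_injectives S"
  unfolding enough_projectives_def enough_injectives_def projective_objects_op etriangle_op op_ext_simps by blast

lemma (in additive_category) is_iso_inverseE:
  assumes "is_iso C A B f"
  obtains g where "is_iso C B A g" "f \<in> arr C A B" "g \<in> arr C B A" "g \<cdot> f = Idn C A" "f \<cdot> g = Idn C B"
  using assms by (auto simp: is_iso_def)

lemma (in additive_category) seq_class_iff:
  "(B', x', y') \<in> seq_class C A x B y Z \<longleftrightarrow> x' \<in> arr C A B' \<and> y' \<in> arr C B' Z \<and>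
     (\<exists>b. is_iso C B B' b \<and> b \<cdot> x = x' \<and> y' \<cdot> b = y)"
  by (simp add: seq_class_def)

lemma subcategory_op:
  assumes "subcategory S X"
  shows "subcategory (op_ext S) X"
proof -
  have "T \<in> X" if B: "B \<in> X" and iso: "is_iso S T B f" for B T f
  proof -
    obtain g where "is_iso S B T g"
      using iso by (auto simp: is_iso_def)
    then show ?thesis
      by (rule subcategoryD(2)[OF assms B])
  qed
  then show ?thesis
    using assms unfolding subcategory_def op_ext_simps is_iso_op zero_object_op direct_sum_op
    by (elim conjE, intro conjI) (assumption | blast)+
qed

context extriangulated_category
begin

text \<open>
  Equivalence of sequences is a symmetric relation, but its witness, an isomorphism of the middle
  terms, has to be inverted when all morphisms are reversed.
\<close>

lemma real_class_op:
  assumes "\<delta> \<in> exts S A Z"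
  shows "\<exists>B x y. x \<in> arr (op_ext S) A B \<and> y \<in> arr (op_ext S) B Z \<and>
    Real (op_ext S) Z A \<delta> = seq_class (op_ext S) A x B y Z"
proof -
  obtain B y x where y: "y \<in> arr S Z B" and x: "x \<in> arr S B A" and R: "Real S A Z \<delta> = seq_class S Z y B x A"
    using real_class[OF assms] by blast
  have "(\<exists>b. is_iso S B B' b \<and> b \<cdot> y = y' \<and> x' \<cdot> b = x) \<longleftrightarrow>
      (\<exists>b. is_iso S B' B b \<and> x \<cdot> b = x' \<and> b \<cdot> y' = y)"
    if "y' \<in> arr S Z B'" "x' \<in> arr S B' A" for B' x' y'
  proof
    assume "\<exists>b. is_iso S B B' b \<and> b \<cdot> y = y' \<and> x' \<cdot> b = x"
    then obtain b where b: "is_iso S B B' b" "b \<cdot> y = y'" "x' \<cdot> b = x" by blast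
    obtain b' where b': "is_iso S B' B b'" "b \<in> arr S B B'" "b' \<in> arr S B' B" "b' \<cdot> b = Idn S B" "b \<cdot> b' = Idn S B'"
      using b(1) by (rule is_iso_inverseE)
    have "x \<cdot> b' = x'"
      using comp_assoc[OF b'(3,2) that(2)] b(3) b'(5) id_right[OF that(2)] by simp
    moreover have "b' \<cdot> y' = y"
      using comp_assoc[OF y b'(2,3)] b(2) b'(4) id_left[OF y] by simp
    ultimately show "\<exists>b. is_iso S B' B b \<and> x \<cdot> b = x' \<and> b \<cdot> y' = y"
      using b'(1) by blast
  next
    assume "\<exists>b. is_iso S B' B b \<and> x \<cdot> b = x' \<and> b \<cdot> y' = y"
    then obtain b where b: "is_iso S B' B b" "x \<cdot> b = x'" "b \<cdot> y' = y" by blast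
    obtain b' where b': "is_iso S B B' b'" "b \<in> arr S B' B" "b' \<in> arr S B B'" "b' \<cdot> b = Idn S B'" "b \<cdot> b' = Idn S B"
      using b(1) by (rule is_iso_inverseE)
    have "x' \<cdot> b' = x"
      using comp_assoc[OF b'(3,2) x] b(2) b'(5) id_right[OF x] by simp
    moreover have "b' \<cdot> y = y'"
      using comp_assoc[OF that(1) b'(2,3)] b(3) b'(4) id_left[OF that(1)] by simp
    ultimately show "\<exists>b. is_iso S B B' b \<and> b \<cdot> y = y' \<and> x' \<cdot> b = x"
      using b'(1) by blast
  qed
  then have "(B', x', y') \<in> Real (op_ext S) Z A \<delta> \<longleftrightarrow> (B', x', y') \<in> seq_class (op_ext S) A x B y Z"
    for B' x' y'
    by (simp add: R seq_class_def) blast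
  then have "Real (op_ext S) Z A \<delta> = seq_class (op_ext S) A x B y Z"
    by auto
  then show ?thesis
    using x y by auto
qed

lemma extriangulated_op: "extriangulated_category (op_ext S)"
proof (intro extriangulated_category.intro additive_category.intro extriangulated_category_axioms.intro)
  show "A = A' \<and> B = B'" if "f \<in> arr (op_ext S) A B" "f \<in> arr (op_ext S) A' B'" for f A B A' B'
    using that hom_disjoint by simp
  show "comm_group (Hom (op_ext S) A B)" if "A \<in> Obj (op_ext S)" "B \<in> Obj (op_ext S)" for A B
    using that hom_group by simp
  show "Idn (op_ext S) A \<in> arr (op_ext S) A A" if "A \<in> Obj (op_ext S)" for A
    using that id_arr by simp
  show "g \<cdot>\<^bsub>op_ext S\<^esub> f \<in> arr (op_ext S) A D"
    if "f \<in> arr (op_ext S) A B" "g \<in> arr (op_ext S) B D" for f g A B D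
    using that comp_arr by simp
  show "h \<cdot>\<^bsub>op_ext S\<^esub> (g \<cdot>\<^bsub>op_ext S\<^esub> f) = (h \<cdot>\<^bsub>op_ext S\<^esub> g) \<cdot>\<^bsub>op_ext S\<^esub> f"
    if "f \<in> arr (op_ext S) A B" "g \<in> arr (op_ext S) B D" "h \<in> arr (op_ext S) D E" for f g h A B D E
    using that comp_assoc[of h E D g B f A] by simp
  show "Idn (op_ext S) B \<cdot>\<^bsub>op_ext S\<^esub> f = f" if "f \<in> arr (op_ext S) A B" for f A B
    using that id_right by simp
  show "f \<cdot>\<^bsub>op_ext S\<^esub> Idn (op_ext S) A = f" if "f \<in> arr (op_ext S) A B" for f A B
    using that id_left by simp
  show "(\<lambda>g. g \<cdot>\<^bsub>op_ext S\<^esub> f) \<in> hom (Hom (op_ext S) B D) (Hom (op_ext S) A D)"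
    if "f \<in> arr (op_ext S) A B" "D \<in> Obj (op_ext S)" for f A B D
    using that comp_add_right by simp
  show "(\<lambda>f. g \<cdot>\<^bsub>op_ext S\<^esub> f) \<in> hom (Hom (op_ext S) A B) (Hom (op_ext S) A D)"
    if "g \<in> arr (op_ext S) B D" "A \<in> Obj (op_ext S)" for g A B D
    using that comp_add_left by simp
  show "\<exists>Z. zero_object (op_ext S) Z"
    using has_zero_object by simp
  show "\<exists>T. direct_sum (op_ext S) A B T" if "A \<in> Obj (op_ext S)" "B \<in> Obj (op_ext S)" for A B
    using that has_direct_sums by simp
  show "comm_group (Ext (op_ext S) Z A)" if "Z \<in> Obj (op_ext S)" "A \<in> Obj (op_ext S)" for Z A
    using that ext_group by simp
  show "Push (op_ext S) Z a \<in> hom (Ext (op_ext S) Z A) (Ext (op_ext S) Z A')"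
    if "Z \<in> Obj (op_ext S)" "a \<in> arr (op_ext S) A A'" for Z a A A'
    using that pull_hom[of Z a A' A] by (simp add: hom_def Pi_def)
  show "Pull (op_ext S) c A \<in> hom (Ext (op_ext S) Z A) (Ext (op_ext S) Z' A)"
    if "A \<in> Obj (op_ext S)" "c \<in> arr (op_ext S) Z' Z" for A c Z Z'
    using that push_hom[of A c Z Z'] by (simp add: hom_def Pi_def)
  show "Push (op_ext S) Z (Idn (op_ext S) A) \<delta> = \<delta>" if "\<delta> \<in> exts (op_ext S) Z A" for \<delta> Z A
    using that pull_id by simp
  show "Pull (op_ext S) (Idn (op_ext S) Z) A \<delta> = \<delta>" if "\<delta> \<in> exts (op_ext S) Z A" for \<delta> Z A
    using that push_id by simp
  show "Push (op_ext S) Z (a' \<cdot>\<^bsub>op_ext S\<^esub> a) \<delta> = Push (op_ext S) Z a' (Push (op_ext S) Z a \<delta>)"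
    if "\<delta> \<in> exts (op_ext S) Z A" "a \<in> arr (op_ext S) A A'" "a' \<in> arr (op_ext S) A' A''"
    for \<delta> Z A a A' a' A''
    using that pull_comp by simp
  show "Pull (op_ext S) (c \<cdot>\<^bsub>op_ext S\<^esub> c') A \<delta> = Pull (op_ext S) c' A (Pull (op_ext S) c A \<delta>)"
    if "\<delta> \<in> exts (op_ext S) Z A" "c \<in> arr (op_ext S) Z' Z" "c' \<in> arr (op_ext S) Z'' Z'"
    for \<delta> Z A c Z' c' Z''
    using that push_comp by simp
  show "Push (op_ext S) Z' a (Pull (op_ext S) c A \<delta>) = Pull (op_ext S) c A' (Push (op_ext S) Z a \<delta>)"
    if "\<delta> \<in> exts (op_ext S) Z A" "a \<in> arr (op_ext S) A A'" "c \<in> arr (op_ext S) Z' Z"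
    for \<delta> Z A a A' c Z'
    using that push_pull[of \<delta> A Z c Z' a A'] by simp
  show "Push (op_ext S) Z (a \<otimes>\<^bsub>Hom (op_ext S) A A'\<^esub> a') \<delta> =
      Push (op_ext S) Z a \<delta> \<otimes>\<^bsub>Ext (op_ext S) Z A'\<^esub> Push (op_ext S) Z a' \<delta>"
    if "\<delta> \<in> exts (op_ext S) Z A" "a \<in> arr (op_ext S) A A'" "a' \<in> arr (op_ext S) A A'"
    for \<delta> Z A a A' a'
    using that pull_add by simp
  show "Pull (op_ext S) (c \<otimes>\<^bsub>Hom (op_ext S) Z' Z\<^esub> c') A \<delta> =
      Pull (op_ext S) c A \<delta> \<otimes>\<^bsub>Ext (op_ext S) Z' A\<^esub> Pull (op_ext S) c' A \<delta>"
    if "\<delta> \<in> exts (op_ext S) Z A" "c \<in> arr (op_ext S) Z' Z" "c' \<in> arr (op_ext S) Z' Z"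
    for \<delta> Z A c Z' c'
    using that push_add by simp
  show "\<exists>B x y. x \<in> arr (op_ext S) A B \<and> y \<in> arr (op_ext S) B Z \<and>
      Real (op_ext S) Z A \<delta> = seq_class (op_ext S) A x B y Z" if "\<delta> \<in> exts (op_ext S) Z A" for \<delta> Z A
    using that real_class_op by simp
  show "\<exists>b\<in>arr (op_ext S) B B'. b \<cdot>\<^bsub>op_ext S\<^esub> x = x' \<cdot>\<^bsub>op_ext S\<^esub> a \<and> y' \<cdot>\<^bsub>op_ext S\<^esub> b = c \<cdot>\<^bsub>op_ext S\<^esub> y"
    if "etriangle (op_ext S) A x B y Z \<delta>" "etriangle (op_ext S) A' x' B' y' Z' \<delta>'"
      "ext_morphism (op_ext S) A Z \<delta> A' Z' \<delta>' a c"
    for A x B y Z \<delta> A' x' B' y' Z' \<delta>' a c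
    using that real_morphism[of Z' y' B' x' A' \<delta>' Z y B x A \<delta> c a] by auto
  show "(B, i, q) \<in> Real (op_ext S) Z A \<one>\<^bsub>Ext (op_ext S) Z A\<^esub>"
    if "biproduct (op_ext S) A Z B i j p q" for A Z B i j p q
    using that real_zero[OF biproduct_swap[of A Z B p q i j]] by simp
  show "(SB,
         (iB \<cdot>\<^bsub>op_ext S\<^esub> x \<cdot>\<^bsub>op_ext S\<^esub> pA) \<otimes>\<^bsub>Hom (op_ext S) SA SB\<^esub> (jB \<cdot>\<^bsub>op_ext S\<^esub> x' \<cdot>\<^bsub>op_ext S\<^esub> qA),
         (iZ \<cdot>\<^bsub>op_ext S\<^esub> y \<cdot>\<^bsub>op_ext S\<^esub> pB) \<otimes>\<^bsub>Hom (op_ext S) SB SZ\<^esub> (jZ \<cdot>\<^bsub>op_ext S\<^esub> y' \<cdot>\<^bsub>op_ext S\<^esub> qB))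
        \<in> Real (op_ext S) SZ SA
            (Push (op_ext S) SZ iA (Pull (op_ext S) pZ A \<delta>) \<otimes>\<^bsub>Ext (op_ext S) SZ SA\<^esub>
             Push (op_ext S) SZ jA (Pull (op_ext S) qZ A' \<delta>'))"
    if t: "etriangle (op_ext S) A x B y Z \<delta>" "etriangle (op_ext S) A' x' B' y' Z' \<delta>'"
      "biproduct (op_ext S) A A' SA iA jA pA qA"
      "biproduct (op_ext S) B B' SB iB jB pB qB"
      "biproduct (op_ext S) Z Z' SZ iZ jZ pZ qZ"
    for A x B y Z \<delta> A' x' B' y' Z' \<delta>' SA iA jA pA qA SB iB jB pB qB SZ iZ jZ pZ qZ
  proof -
    note t' = t[simplified]
    note B = biproductD[OF t'(3)] biproductD[OF t'(4)] biproductD[OF t'(5)]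
    have \<delta>: "\<delta> \<in> exts S A Z" "\<delta>' \<in> exts S A' Z'"
      using t' by (auto simp: etriangle_def)
    have xy: "x \<in> arr S B A" "y \<in> arr S Z B" "x' \<in> arr S B' A'" "y' \<in> arr S Z' B'"
      using t' real_class[OF \<delta>(1)] real_class[OF \<delta>(2)] by (auto simp: etriangle_def seq_class_def)
    have "(pA \<cdot> x) \<cdot> iB = pA \<cdot> (x \<cdot> iB)" "(qA \<cdot> x') \<cdot> jB = qA \<cdot> (x' \<cdot> jB)"
      "(pB \<cdot> y) \<cdot> iZ = pB \<cdot> (y \<cdot> iZ)" "(qB \<cdot> y') \<cdot> jZ = qB \<cdot> (y' \<cdot> jZ)"
      using comp_assoc xy B by metis+
    moreover have "Push S SA pZ (Pull S iA Z \<delta>) = Pull S iA SZ (Push S A pZ \<delta>)"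
      "Push S SA qZ (Pull S jA Z' \<delta>') = Pull S jA SZ (Push S A' qZ \<delta>')"
      using push_pull[OF \<delta>(1) B(19) B(3)] push_pull[OF \<delta>(2) B(20) B(4)] by simp_all
    ultimately show ?thesis
      using real_sum[OF t'(1,2,5,4,3)] by simp
  qed
  show "\<exists>c. c \<cdot>\<^bsub>op_ext S\<^esub> y = y' \<cdot>\<^bsub>op_ext S\<^esub> b \<and> ext_morphism (op_ext S) A Z \<delta> A' Z' \<delta>' a c"
    if "etriangle (op_ext S) A x B y Z \<delta>" "etriangle (op_ext S) A' x' B' y' Z' \<delta>'"
      "a \<in> arr (op_ext S) A A'" "b \<in> arr (op_ext S) B B'" "b \<cdot>\<^bsub>op_ext S\<^esub> x = x' \<cdot>\<^bsub>op_ext S\<^esub> a"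
    for A x B y Z \<delta> A' x' B' y' Z' \<delta>' a b
    using that ET3_op[of Z' y' B' x' A' \<delta>' Z y B x A \<delta> b a] by simp
  show "\<exists>a. x' \<cdot>\<^bsub>op_ext S\<^esub> a = b \<cdot>\<^bsub>op_ext S\<^esub> x \<and> ext_morphism (op_ext S) A Z \<delta> A' Z' \<delta>' a c"
    if "etriangle (op_ext S) A x B y Z \<delta>" "etriangle (op_ext S) A' x' B' y' Z' \<delta>'"
      "b \<in> arr (op_ext S) B B'" "c \<in> arr (op_ext S) Z Z'" "y' \<cdot>\<^bsub>op_ext S\<^esub> b = c \<cdot>\<^bsub>op_ext S\<^esub> y"
    for A x B y Z \<delta> A' x' B' y' Z' \<delta>' b c
    using that ET3[of Z' y' B' x' A' \<delta>' Z y B x A \<delta> c b] by simp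
  show "\<exists>E h' d e \<delta>''.
      h' \<in> arr (op_ext S) C E \<and> d \<in> arr (op_ext S) D E \<and> e \<in> arr (op_ext S) E F \<and>
      h' \<cdot>\<^bsub>op_ext S\<^esub> g = d \<cdot>\<^bsub>op_ext S\<^esub> f' \<and> e \<cdot>\<^bsub>op_ext S\<^esub> h' = g' \<and>
      etriangle (op_ext S) A (g \<cdot>\<^bsub>op_ext S\<^esub> f) C h' E \<delta>'' \<and>
      etriangle (op_ext S) D d E e F (Push (op_ext S) F f' \<delta>') \<and>
      Pull (op_ext S) d A \<delta>'' = \<delta> \<and> Push (op_ext S) E f \<delta>'' = Pull (op_ext S) e B \<delta>'"
    if "etriangle (op_ext S) A f B f' D \<delta>" "etriangle (op_ext S) B g C g' F \<delta>'"
    for A f B f' D \<delta> g C g' F \<delta>'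
    using that ET4_op[of D f' B f A \<delta> F g' C g \<delta>'] by simp
  show "\<exists>E h' d e \<delta>''.
      h' \<in> arr (op_ext S) E C \<and> d \<in> arr (op_ext S) E D \<and> e \<in> arr (op_ext S) F E \<and>
      g \<cdot>\<^bsub>op_ext S\<^esub> h' = f' \<cdot>\<^bsub>op_ext S\<^esub> d \<and> h' \<cdot>\<^bsub>op_ext S\<^esub> e = g' \<and>
      etriangle (op_ext S) E h' C (f \<cdot>\<^bsub>op_ext S\<^esub> g) A \<delta>'' \<and>
      etriangle (op_ext S) F e E d D (Pull (op_ext S) f' F \<delta>') \<and>
      Push (op_ext S) A d \<delta>'' = \<delta> \<and> Pull (op_ext S) f E \<delta>'' = Push (op_ext S) B e \<delta>'"
    if "etriangle (op_ext S) D f' B f A \<delta>" "etriangle (op_ext S) F g' C g B \<delta>'"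
    for D f' B f A \<delta> F g' C g \<delta>'
    using that ET4[of A f B f' D \<delta> g C g' F \<delta>'] by simp
qed

end


section \<open>Exactness and splitting\<close>

text \<open>The group \<open>\<bbbE>(Z, A)\<close> vanishes; this holds vacuously if \<open>Z\<close> or \<open>A\<close> is not an object.\<close>

definition ext_trivial :: "('o, 'm, 'e, 'z) ext_data_scheme \<Rightarrow> 'o \<Rightarrow> 'o \<Rightarrow> bool" where
  "ext_trivial S Z A \<longleftrightarrow> exts S Z A \<subseteq> {\<one>\<^bsub>Ext S Z A\<^esub>}"

lemma ext_trivialD: "\<lbrakk>ext_trivial S Z A; \<delta> \<in> exts S Z A\<rbrakk> \<Longrightarrow> \<delta> = \<one>\<^bsub>Ext S Z A\<^esub>"
  by (auto simp: ext_trivial_def)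

lemma ext_trivial_op [simp]: "ext_trivial (op_ext S) Z A \<longleftrightarrow> ext_trivial S A Z"
  by (simp add: ext_trivial_def)

lemma extsD:
  assumes "\<delta> \<in> exts S Z A"
  shows "Z \<in> Obj S" "A \<in> Obj S" "\<delta> \<in> carrier (Ext S Z A)"
  using assms by (auto simp: exts_def)

context extriangulated_category
begin

lemma etriangleD:
  assumes "etriangle S A x B y Z \<delta>"
  shows "x \<in> arr S A B" "y \<in> arr S B Z" "\<delta> \<in> exts S Z A" "A \<in> Obj S" "B \<in> Obj S" "Z \<in> Obj S"
proof -
  show \<delta>: "\<delta> \<in> exts S Z A"
    using assms by (simp add: etriangle_def)
  show x: "x \<in> arr S A B" and "y \<in> arr S B Z"
    using assms real_class[OF \<delta>] by (auto simp: etriangle_def seq_class_def)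
  show "A \<in> Obj S" "B \<in> Obj S" "Z \<in> Obj S"
    using arrD[OF x] extsD[OF \<delta>] by auto
qed

lemma etriangle_exists:
  assumes "\<delta> \<in> exts S Z A"
  obtains B x y where "etriangle S A x B y Z \<delta>"
proof -
  obtain B x y where *: "x \<in> arr S A B" "y \<in> arr S B Z" "Real S Z A \<delta> = seq_class S A x B y Z"
    using real_class[OF assms] by blast
  have "is_iso S B B (Idn S B)"
    using id_arr[OF arrD(2)[OF *(1)]] id_left by (auto simp: is_iso_def)
  then have "(B, x, y) \<in> Real S Z A \<delta>"
    unfolding *(3) seq_class_iff using *(1,2) id_left[OF *(1)] id_right[OF *(2)] by blast
  then show thesis
    using that assms by (simp add: etriangle_def)
qed

lemma ext_null: "\<lbrakk>Z \<in> Obj S; A \<in> Obj S\<rbrakk> \<Longrightarrow> \<one>\<^bsub>Ext S Z A\<^esub> \<in> exts S Z A"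
  using ext_group[of Z A] by (simp add: exts_def comm_group_def group.is_monoid)

lemma ext_trivialI:
  "(\<And>\<delta>. \<delta> \<in> exts S Z A \<Longrightarrow> \<delta> = \<one>\<^bsub>Ext S Z A\<^esub>) \<Longrightarrow> ext_trivial S Z A"
  by (auto simp: ext_trivial_def)

lemma ext_vanishes_iff:
  assumes "U \<subseteq> Obj S" "V \<subseteq> Obj S"
  shows "ext_vanishes S U V \<longleftrightarrow> (\<forall>Z \<in> U. \<forall>A \<in> V. ext_trivial S Z A)"
proof -
  have "carrier (Ext S Z A) = {\<one>\<^bsub>Ext S Z A\<^esub>} \<longleftrightarrow> ext_trivial S Z A" if "Z \<in> U" "A \<in> V" for Z A
    using ext_null[of Z A] assms that by (auto simp: ext_trivial_def exts_def)
  then show ?thesis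
    by (auto simp: ext_vanishes_def)
qed

lemma push_ext: "\<lbrakk>\<delta> \<in> exts S Z A; a \<in> arr S A A'\<rbrakk> \<Longrightarrow> Push S Z a \<delta> \<in> exts S Z A'"
  using push_hom[of Z a A A'] by (auto simp: exts_def hom_def arr_def)

lemma push_null: "\<lbrakk>Z \<in> Obj S; a \<in> arr S A A'\<rbrakk> \<Longrightarrow> Push S Z a \<one>\<^bsub>Ext S Z A\<^esub> = \<one>\<^bsub>Ext S Z A'\<^esub>"
  using hom_one[OF push_hom[of Z a A A']] ext_group[of Z A] ext_group[of Z A']
  by (auto simp: comm_group_def arr_def)

lemma pull_ext: "\<lbrakk>\<delta> \<in> exts S Z A; c \<in> arr S Z' Z\<rbrakk> \<Longrightarrow> Pull S c A \<delta> \<in> exts S Z' A"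
  using extriangulated_category.push_ext[OF extriangulated_op] by simp

lemma pull_null: "\<lbrakk>A \<in> Obj S; c \<in> arr S Z' Z\<rbrakk> \<Longrightarrow> Pull S c A \<one>\<^bsub>Ext S Z A\<^esub> = \<one>\<^bsub>Ext S Z' A\<^esub>"
  using extriangulated_category.push_null[OF extriangulated_op] by simp

lemma etriangle_unique:
  assumes "etriangle S A x B y Z \<delta>" "etriangle S A x' B' y' Z \<delta>"
  obtains b b' where "b \<in> arr S B B'" "b' \<in> arr S B' B" "b' \<cdot> b = Idn S B" "b \<cdot> b' = Idn S B'"
    "b \<cdot> x = x'" "y' \<cdot> b = y"
proof -
  have \<delta>: "\<delta> \<in> exts S Z A"
    using assms by (simp add: etriangle_def)
  obtain T s t where st: "s \<in> arr S A T" "t \<in> arr S T Z" "Real S Z A \<delta> = seq_class S A s T t Z"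
    using real_class[OF \<delta>] by blast
  obtain c where c: "is_iso S T B c" "c \<cdot> s = x" "y \<cdot> c = t"
    using assms(1) unfolding etriangle_def st(3) seq_class_iff by blast
  obtain d where d: "is_iso S T B' d" "d \<cdot> s = x'" "y' \<cdot> d = t"
    using assms(2) unfolding etriangle_def st(3) seq_class_iff by blast
  obtain c' where c': "c \<in> arr S T B" "c' \<in> arr S B T" "c' \<cdot> c = Idn S T" "c \<cdot> c' = Idn S B"
    using c(1) by (rule is_iso_inverseE)
  obtain d' where d': "d \<in> arr S T B'" "d' \<in> arr S B' T" "d' \<cdot> d = Idn S T" "d \<cdot> d' = Idn S B'"
    using d(1) by (rule is_iso_inverseE)
  note y = etriangleD(2)[OF assms(1)] etriangleD(2)[OF assms(2)]
  have cancel: "(h \<cdot> g) \<cdot> (g' \<cdot> f) = h \<cdot> f"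
    if "f \<in> arr S D T" "g' \<in> arr S T E" "g \<in> arr S E T" "h \<in> arr S T F" "g \<cdot> g' = Idn S T"
    for f g g' h D E F
    using comp_assoc[OF comp_arr[OF that(1,2)] that(3,4)] comp_assoc[OF that(1-3)] that(5)
      id_left[OF that(1)] by simp
  have 1: "(d \<cdot> c') \<cdot> (c \<cdot> d') = Idn S B'" "(c \<cdot> d') \<cdot> (d \<cdot> c') = Idn S B"
    using cancel[OF d'(2) c'(1,2) d'(1) c'(3)] cancel[OF c'(2) d'(1,2) c'(1) d'(3)] d'(4) c'(4)
    by simp_all
  have 2: "(d \<cdot> c') \<cdot> x = x'"
    using cancel[OF st(1) c'(1,2) d'(1) c'(3)] c(2) d(2) by simp
  have "y' \<cdot> (d \<cdot> c') = t \<cdot> c'"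
    using comp_assoc[OF c'(2) d'(1) y(2)] d(3) by simp
  also have "\<dots> = y"
    using comp_assoc[OF c'(2,1) y(1)] c(3) c'(4) id_right[OF y(1)] by simp
  finally show thesis
    using that[OF comp_arr[OF c'(2) d'(1)] comp_arr[OF d'(2) c'(1)] 1(2,1) 2] by simp
qed

lemma etriangle_split:
  assumes "biproduct S A Z B i j p q"
  shows "etriangle S A i B q Z \<one>\<^bsub>Ext S Z A\<^esub>"
  using real_zero[OF assms] ext_null biproductD[OF assms] arrD by (metis etriangle_def)

lemma split_etriangle:
  assumes "etriangle S A x B y Z \<one>\<^bsub>Ext S Z A\<^esub>"
  obtains j p where "biproduct S A Z B x j p y"
proof -
  obtain T i j p q where b: "biproduct S A Z T i j p q"
    using has_direct_sums etriangleD(4,6)[OF assms] unfolding direct_sum_def by blast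
  obtain h k where h: "h \<in> arr S B T" "k \<in> arr S T B" "k \<cdot> h = Idn S B" "h \<cdot> k = Idn S T"
    "h \<cdot> x = i" "q \<cdot> h = y"
    using etriangle_unique[OF assms etriangle_split[OF b]] by blast
  have "k \<cdot> i = x"
    using comp_assoc[OF etriangleD(1)[OF assms] h(1,2)] h(3,5) id_left[OF etriangleD(1)[OF assms]]
    by simp
  then show thesis
    using that biproduct_transport[OF b h(1,2,4,3)] h(6) by simp
qed

lemma etriangle_direct_sum:
  "etriangle S A x B y Z \<one>\<^bsub>Ext S Z A\<^esub> \<Longrightarrow> direct_sum S A Z B"
  unfolding direct_sum_def by (blast elim: split_etriangle)

lemma lift_along_deflation:
  assumes t: "etriangle S A x B y Z \<delta>" and f: "f \<in> arr S W Z" and "Pull S f A \<delta> = \<one>\<^bsub>Ext S W A\<^esub>"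
  obtains g where "g \<in> arr S W B" "y \<cdot> g = f"
proof -
  note T = etriangleD[OF t]
  obtain D i j p q where b: "biproduct S A W D i j p q"
    using has_direct_sums[OF T(4) arrD(1)[OF f]] unfolding direct_sum_def by blast
  note B = biproductD[OF b]
  \<comment> \<open>the split conflation on \<open>A \<oplus> W\<close> realizes the pullback along \<open>f\<close>\<close>
  have "ext_morphism S A W \<one>\<^bsub>Ext S W A\<^esub> A Z \<delta> (Idn S A) f"
    unfolding ext_morphism_def
    using id_arr[OF T(4)] f push_null[OF arrD(1)[OF f] id_arr[OF T(4)]] assms(3) by simp
  then obtain b where b': "b \<in> arr S D B" "y \<cdot> b = f \<cdot> q"
    using real_morphism[OF etriangle_split[OF b] t] by blast
  have "y \<cdot> (b \<cdot> j) = f"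
    using comp_assoc[OF B(2) b'(1) T(2)] comp_assoc[OF B(2) B(4) f] b'(2) B(6) id_right[OF f] by simp
  then show thesis
    using that[OF comp_arr[OF B(2) b'(1)]] by blast
qed

lemma extend_along_inflation:
  assumes "etriangle S A x B y Z \<delta>" "f \<in> arr S A W" "Push S Z f \<delta> = \<one>\<^bsub>Ext S Z W\<^esub>"
  obtains g where "g \<in> arr S B W" "g \<cdot> x = f"
  using extriangulated_category.lift_along_deflation[OF extriangulated_op, of Z y B x A \<delta> f W] assms
  by auto

lemma pull_deflation:
  assumes t: "etriangle S A x B y Z \<delta>"
  shows "Pull S y A \<delta> = \<one>\<^bsub>Ext S B A\<^esub>"
proof -
  note T = etriangleD[OF t]
  obtain N where N: "zero_object S N"
    using has_zero_object by blast
  \<comment> \<open>\<open>y\<close> is part of a morphism from the split conflation \<open>0 \<rightarrow> B \<rightarrow> B\<close>, given by \<open>1\<close> on the middle terms\<close>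
  note t0 = etriangle_split[OF biproduct_swap[OF biproduct_zero_object[OF N T(5)]]]
  obtain a where "ext_morphism S N B \<one>\<^bsub>Ext S B N\<^esub> A Z \<delta> a y"
    using ET3_op[OF t0 t id_arr[OF T(5)] T(2)] by blast
  then show ?thesis
    unfolding ext_morphism_def using push_null[OF T(5)] by metis
qed

lemma push_inflation:
  "etriangle S A x B y Z \<delta> \<Longrightarrow> Push S Z x \<delta> = \<one>\<^bsub>Ext S Z B\<^esub>"
  using extriangulated_category.pull_deflation[OF extriangulated_op, of Z y B x A \<delta>] by simp

text \<open>
  Exactness of \<open>Hom(W, Z) \<rightarrow> \<bbbE>(W, A) \<rightarrow> \<bbbE>(W, B)\<close> in the middle.
\<close>

lemma push_inflation_kernel:
  assumes t: "etriangle S A x B y Z \<delta>" and \<epsilon>: "\<epsilon> \<in> exts S W A" and "Push S W x \<epsilon> = \<one>\<^bsub>Ext S W B\<^esub>"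
  obtains f where "f \<in> arr S W Z" "Pull S f A \<delta> = \<epsilon>"
proof -
  note T = etriangleD[OF t]
  obtain M a b where m: "etriangle S A a M b W \<epsilon>"
    using etriangle_exists[OF \<epsilon>] by blast
  obtain g where g: "g \<in> arr S M B" "g \<cdot> a = x"
    using extend_along_inflation[OF m T(1) assms(3)] by blast
  obtain f where "ext_morphism S A W \<epsilon> A Z \<delta> (Idn S A) f"
    using ET3[OF m t id_arr[OF T(4)] g(1)] g(2) id_right[OF T(1)] by auto
  then show thesis
    using that push_id[OF \<epsilon>] unfolding ext_morphism_def by auto
qed

lemma pull_deflation_kernel:
  assumes "etriangle S A x B y Z \<delta>" "\<epsilon> \<in> exts S Z W" "Pull S y W \<epsilon> = \<one>\<^bsub>Ext S B W\<^esub>"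
  obtains f where "f \<in> arr S A W" "Push S Z f \<delta> = \<epsilon>"
  using extriangulated_category.push_inflation_kernel[OF extriangulated_op, of Z y B x A \<delta> \<epsilon> W] assms
  by auto

text \<open>
  Exactness of \<open>\<bbbE>(Z, W) \<rightarrow> \<bbbE>(B, W) \<rightarrow> \<bbbE>(A, W)\<close> in the middle: an extension of \<open>B\<close> that splits over \<open>A\<close>
  comes from an extension of \<open>Z\<close>, which is found by composing deflations.
\<close>

lemma pull_inflation_kernel:
  assumes t: "etriangle S A x B y Z \<delta>" and \<epsilon>: "\<epsilon> \<in> exts S B W" and "Pull S x W \<epsilon> = \<one>\<^bsub>Ext S A W\<^esub>"
  obtains \<zeta> where "\<zeta> \<in> exts S Z W" "Pull S y W \<zeta> = \<epsilon>"
proof -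
  note T = etriangleD[OF t]
  obtain M a b where m: "etriangle S W a M b B \<epsilon>"
    using etriangle_exists[OF \<epsilon>] by blast
  \<comment> \<open>\<open>\<epsilon>\<close> splits over \<open>A\<close>, so \<open>e\<close> has a retraction \<open>r\<close>, which carries \<open>\<eta>\<close> to the required extension\<close>
  obtain E h' d e \<eta> where E: "etriangle S E h' M (y \<cdot> b) Z \<eta>"
    "etriangle S W e E d A (Pull S x W \<epsilon>)" "Pull S y E \<eta> = Push S B e \<epsilon>"
    using ET4_op[OF t m] by blast
  obtain j r where "biproduct S W A E e j r d"
    using split_etriangle E(2) assms(3) by metis
  note r = biproductD(3,5)[OF this]
  have "Pull S y W (Push S Z r \<eta>) = Push S B r (Push S B e \<epsilon>)"
    using push_pull[OF etriangleD(3)[OF E(1)] r(1) T(2)] E(3) by simp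
  also have "\<dots> = \<epsilon>"
    using push_comp[OF \<epsilon> etriangleD(1)[OF E(2)] r(1)] r(2) push_id[OF \<epsilon>] by simp
  finally show thesis
    using that[OF push_ext[OF etriangleD(3)[OF E(1)] r(1)]] by blast
qed

lemma ext_trivial_middle_left:
  assumes t: "etriangle S A x B y Z \<delta>" and "ext_trivial S A W" "ext_trivial S Z W"
  shows "ext_trivial S B W"
proof (rule ext_trivialI)
  fix \<epsilon> assume \<epsilon>: "\<epsilon> \<in> exts S B W"
  note T = etriangleD[OF t]
  obtain \<zeta> where \<zeta>: "\<zeta> \<in> exts S Z W" "Pull S y W \<zeta> = \<epsilon>"
    using pull_inflation_kernel[OF t \<epsilon> ext_trivialD[OF assms(2) pull_ext[OF \<epsilon> T(1)]]] by blast
  then show "\<epsilon> = \<one>\<^bsub>Ext S B W\<^esub>"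
    using ext_trivialD[OF assms(3) \<zeta>(1)] pull_null[OF extsD(2)[OF \<epsilon>] T(2)] by simp
qed

end


section \<open>Direct sums of conflations and deflations\<close>

context extriangulated_category
begin

text \<open>The direct sum of a conflation with \<open>0 \<rightarrow> Y \<rightarrow> Y\<close>.\<close>

lemma etriangle_add_object:
  assumes t: "etriangle S A x B y Z \<delta>"
    and bB: "biproduct S B Y T i j p q" and bZ: "biproduct S Z Y T' i' j' p' q'"
  shows "etriangle S A (i \<cdot> x) T ((i' \<cdot> y \<cdot> p) \<otimes>\<^bsub>Hom S T T'\<^esub> (j' \<cdot> q)) T' (Pull S p' A \<delta>)"
proof -
  note t' = etriangleD[OF t]
  note B = biproductD[OF bB] and B' = biproductD[OF bZ]
  obtain N where N: "zero_object S N"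
    using has_zero_object by blast
  then have "N \<in> Obj S"
    unfolding zero_object_def by blast
  have Y: "Y \<in> Obj S"
    using arrD[OF B(2)] by simp
  note nY = null_arr[OF \<open>N \<in> Obj S\<close> Y] and nA = null_arr[OF t'(4) \<open>N \<in> Obj S\<close>] null_arr[OF \<open>N \<in> Obj S\<close> t'(4)]
  note tY = etriangle_split[OF biproduct_swap[OF biproduct_zero_object[OF N Y]]]
  note bA = biproduct_zero_object[OF N t'(4)]
  have ix: "i \<cdot> x \<in> arr S A T"
    using comp_arr[OF t'(1) B(1)] .
  have \<epsilon>: "Pull S p' A \<delta> \<in> exts S T' A"
    using pull_ext[OF t'(3) B'(3)] .
  have 1: "(i \<cdot> x \<cdot> Idn S A) \<otimes>\<^bsub>Hom S A T\<^esub> (j \<cdot> \<one>\<^bsub>Hom S N Y\<^esub> \<cdot> \<one>\<^bsub>Hom S A N\<^esub>) = i \<cdot> x"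
    using id_right[OF ix] comp_null_right[OF comp_arr[OF nY B(2)] t'(4)] add_null_right[OF ix] by simp
  have 2: "j' \<cdot> Idn S Y \<cdot> q = j' \<cdot> q"
    using id_right[OF B'(2)] by simp
  have 3: "Push S T' (Idn S A) (Pull S p' A \<delta>) \<otimes>\<^bsub>Ext S T' A\<^esub>
      Push S T' \<one>\<^bsub>Hom S N A\<^esub> (Pull S q' N \<one>\<^bsub>Ext S Y N\<^esub>) = Pull S p' A \<delta>"
    using push_id[OF \<epsilon>] pull_null[OF \<open>N \<in> Obj S\<close> B'(4)] push_null[OF extsD(1)[OF \<epsilon>] nA(2)]
      ext_group[OF extsD(1,2)[OF \<epsilon>]] extsD(3)[OF \<epsilon>]
    by (simp add: comm_group_def group.is_monoid)
  show ?thesis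
    using real_sum[OF t tY bA bB bZ] \<epsilon> unfolding 1 2 3 by (simp add: etriangle_def)
qed

text \<open>
  If \<open>y : P \<rightarrow> C\<close> is a deflation and \<open>g : Z \<rightarrow> C\<close> is arbitrary, then \<open>[g, y] : Z \<oplus> P \<rightarrow> C\<close> is a deflation:
  it is the deflation \<open>1 \<oplus> y\<close> followed by the split epimorphism \<open>[g, 1] : Z \<oplus> C \<rightarrow> C\<close>.
\<close>

lemma deflation_copair:
  assumes t: "etriangle S K x P y C \<delta>" and b: "biproduct S Z P W i j p q" and g: "g \<in> arr S Z C"
  obtains K' x' \<delta>' where "etriangle S K' x' W ((g \<cdot> p) \<otimes>\<^bsub>Hom S W C\<^esub> (y \<cdot> q)) C \<delta>'"
proof -
  note t' = etriangleD[OF t]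
  note B = biproductD[OF b]
  obtain T k l r s where bT: "biproduct S C Z T k l r s"
    using has_direct_sums[OF t'(6) arrD(1)[OF g]] unfolding direct_sum_def by blast
  note T = biproductD[OF bT]
  define \<phi> where "\<phi> = (Idn S C \<cdot> r) \<otimes>\<^bsub>Hom S T C\<^esub> (g \<cdot> s)"
  note \<Phi> = biproduct_copair[OF bT id_arr[OF t'(6)] g, folded \<phi>_def]
  \<comment> \<open>the kernel of \<open>\<phi> = [1, g]\<close> on \<open>T = C \<oplus> Z\<close> is \<open>m = l - k g : Z \<rightarrow> T\<close>\<close>
  have kg: "k \<cdot> g \<in> arr S Z T"
    using comp_arr[OF g T(1)] .
  note ng = neg_arr[OF kg]
  define m where "m = l \<otimes>\<^bsub>Hom S Z T\<^esub> inv\<^bsub>Hom S Z T\<^esub> (k \<cdot> g)"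
  have m: "m \<in> arr S Z T"
    unfolding m_def by (rule add_arr[OF T(2) ng])
  have zero_m: "\<phi> \<cdot> m = \<one>\<^bsub>Hom S Z C\<^esub>"
  proof -
    have "\<phi> \<cdot> m = (\<phi> \<cdot> l) \<otimes>\<^bsub>Hom S Z C\<^esub> inv\<^bsub>Hom S Z C\<^esub> (\<phi> \<cdot> (k \<cdot> g))"
      unfolding m_def using add_comp[OF T(2) ng \<Phi>(1)] comp_neg[OF kg \<Phi>(1)] by simp
    also have "\<phi> \<cdot> (k \<cdot> g) = g"
      using comp_assoc[OF g T(1) \<Phi>(1)] \<Phi>(2) id_left[OF g] by simp
    finally show ?thesis
      using \<Phi>(3) add_neg[OF g] by simp
  qed
  have s_m: "s \<cdot> m = Idn S Z"
  proof -
    have "s \<cdot> m = (s \<cdot> l) \<otimes>\<^bsub>Hom S Z Z\<^esub> inv\<^bsub>Hom S Z Z\<^esub> (s \<cdot> (k \<cdot> g))"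
      unfolding m_def using add_comp[OF T(2) ng T(4)] comp_neg[OF kg T(4)] by simp
    also have "s \<cdot> (k \<cdot> g) = \<one>\<^bsub>Hom S Z Z\<^esub>"
      using comp_assoc[OF g T(1) T(4)] T(7) comp_null_left[OF g arrD(1)[OF g]] by simp
    also have "(s \<cdot> l) \<otimes>\<^bsub>Hom S Z Z\<^esub> inv\<^bsub>Hom S Z Z\<^esub> \<one>\<^bsub>Hom S Z Z\<^esub> = Idn S Z"
      using T(6) hom_group[OF arrD(1)[OF g] arrD(1)[OF g]] add_null_right[OF id_arr[OF arrD(1)[OF g]]]
      by (simp add: comm_group_def group.is_monoid monoid.inv_one)
    finally show ?thesis .
  qed
  have "(m \<cdot> s) \<otimes>\<^bsub>Hom S T T\<^esub> (k \<cdot> \<phi>) = Idn S T"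
  proof (rule biproduct_eqI[OF bT])
    note ms = comp_arr[OF T(4) m] and kf = comp_arr[OF \<Phi>(1) T(1)]
    show "(m \<cdot> s) \<otimes>\<^bsub>Hom S T T\<^esub> (k \<cdot> \<phi>) \<in> arr S T T"
      by (rule add_arr[OF ms kf])
    show "Idn S T \<in> arr S T T"
      using id_arr arrD[OF T(1)] by simp
    show "(m \<cdot> s) \<otimes>\<^bsub>Hom S T T\<^esub> (k \<cdot> \<phi>) \<cdot> k = Idn S T \<cdot> k"
      using comp_add[OF T(1) ms kf] comp_assoc[OF T(1) T(4) m] comp_assoc[OF T(1) \<Phi>(1) T(1)]
        T(7) \<Phi>(2) id_right[OF T(1)] id_left[OF T(1)] comp_null_right[OF m t'(6)] add_null_left[OF T(1)]
      by simp
    have "(m \<cdot> s) \<otimes>\<^bsub>Hom S T T\<^esub> (k \<cdot> \<phi>) \<cdot> l = m \<otimes>\<^bsub>Hom S Z T\<^esub> (k \<cdot> g)"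
      using comp_add[OF T(2) ms kf] comp_assoc[OF T(2) T(4) m] comp_assoc[OF T(2) \<Phi>(1) T(1)]
        T(6) \<Phi>(3) id_right[OF m] by simp
    also have "\<dots> = l"
    proof -
      have "comm_group (Hom S Z T)"
        using hom_group arrD[OF m] by blast
      then interpret H: comm_group "Hom S Z T" .
      show ?thesis
        unfolding m_def using arrD(3)[OF kg] arrD(3)[OF T(2)] by (simp add: H.m_assoc)
    qed
    finally show "(m \<cdot> s) \<otimes>\<^bsub>Hom S T T\<^esub> (k \<cdot> \<phi>) \<cdot> l = Idn S T \<cdot> l"
      using id_left[OF T(2)] by simp
  qed
  then have "biproduct S Z C T m k s \<phi>"
    unfolding biproduct_def using m T(1,4,7) \<Phi>(1,2) s_m zero_m by simp
  note tT = etriangle_split[OF this]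
  define \<psi> where "\<psi> = (k \<cdot> y \<cdot> q) \<otimes>\<^bsub>Hom S W T\<^esub> (l \<cdot> p)"
  have tW: "etriangle S K (j \<cdot> x) W \<psi> T (Pull S r K \<delta>)"
    unfolding \<psi>_def by (rule etriangle_add_object[OF t biproduct_swap[OF b] bT])
  have ky: "k \<cdot> y \<in> arr S P T"
    using comp_arr[OF t'(2) T(1)] .
  have "\<phi> \<cdot> \<psi> = (\<phi> \<cdot> (k \<cdot> y \<cdot> q)) \<otimes>\<^bsub>Hom S W C\<^esub> (\<phi> \<cdot> (l \<cdot> p))"
    unfolding \<psi>_def using add_comp[OF comp_arr[OF B(4) ky] comp_arr[OF B(3) T(2)] \<Phi>(1)] .
  also have "\<phi> \<cdot> (k \<cdot> y \<cdot> q) = y \<cdot> q"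
    using comp_assoc[OF B(4) ky \<Phi>(1)] comp_assoc[OF t'(2) T(1) \<Phi>(1)] \<Phi>(2) id_left[OF t'(2)] by simp
  also have "\<phi> \<cdot> (l \<cdot> p) = g \<cdot> p"
    using comp_assoc[OF B(3) T(2) \<Phi>(1)] \<Phi>(3) by simp
  finally have "\<phi> \<cdot> \<psi> = (g \<cdot> p) \<otimes>\<^bsub>Hom S W C\<^esub> (y \<cdot> q)"
    using add_comm[OF comp_arr[OF B(3) g] comp_arr[OF B(4) t'(2)]] by simp
  then show thesis
    using ET4_op[OF tT tW] that by metis
qed

end

section \<open>Rigid subcategories and their perpendicular categories\<close>

text \<open>
  The standing hypotheses on the rigid subcategory \<open>X\<close> with \<open>\<A> = X\<^sup>\<bottom> = \<^sup>\<bottom>X\<close>, in a form that is visibly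
  invariant under passage to the opposite category. Rigidity is the inclusion \<open>X \<subseteq> \<A>\<close>. The last
  condition says that the objects vanishing modulo \<open>X\<close> are those of \<open>X\<close>; it is derived below from a
  choice of shifts, which is not a self-dual datum.
\<close>

locale rigid_subcategory = extriangulated_category S + additive_category_with_subcategory S X
  for S :: "('o, 'm, 'e, 'z) ext_data_scheme" (structure) and X :: "'o set" +
  fixes \<A> :: "'o set"
  assumes ff: "functorially_finite S X"
    and left_perp: "\<A> = left_perp S X" and right_perp: "\<A> = right_perp S X"
    and X_subset: "X \<subseteq> \<A>"
    and enough_proj: "enough_projectives S" and enough_inj: "enough_injectives S"
    and proj_subset: "projective_objects S \<subseteq> X" and inj_subset: "injective_objects S \<subseteq> X"
    and zero_mod_X: "\<lbrakk>K \<in> Obj S; Idn S K \<in> factoring S X K K\<rbrakk> \<Longrightarrow> K \<in> X"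
begin

lemma perp_obj: "D \<in> \<A> \<Longrightarrow> D \<in> Obj S"
  by (simp add: left_perp left_perp_def)

lemma perp_iff:
  "D \<in> \<A> \<longleftrightarrow> D \<in> Obj S \<and> (\<forall>Y \<in> X. ext_trivial S D Y)"
  "D \<in> \<A> \<longleftrightarrow> D \<in> Obj S \<and> (\<forall>Y \<in> X. ext_trivial S Y D)"
proof -
  have "X \<subseteq> Obj S"
    using subcat_obj by blast
  then show "D \<in> \<A> \<longleftrightarrow> D \<in> Obj S \<and> (\<forall>Y \<in> X. ext_trivial S D Y)"
    using ext_vanishes_iff[of "{D}" X] by (auto simp: left_perp left_perp_def)
  show "D \<in> \<A> \<longleftrightarrow> D \<in> Obj S \<and> (\<forall>Y \<in> X. ext_trivial S Y D)"
    using ext_vanishes_iff[of X "{D}"] \<open>X \<subseteq> Obj S\<close> by (auto simp: right_perp right_perp_def)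
qed

lemma perp_trivial:
  assumes "D \<in> \<A>" "Y \<in> X"
  shows "ext_trivial S D Y" "ext_trivial S Y D"
  using assms perp_iff by blast+

lemma perp_extension: "\<lbrakk>etriangle S A x B y Z \<delta>; A \<in> \<A>; Z \<in> \<A>\<rbrakk> \<Longrightarrow> B \<in> \<A>"
  using perp_iff(1) ext_trivial_middle_left etriangleD(5) by metis

lemma rigid_subcategory_op: "rigid_subcategory (op_ext S) X \<A>"
proof -
  interpret op: extriangulated_category "op_ext S"
    by (rule extriangulated_op)
  have "functorially_finite (op_ext S) X"
    using ff by (auto simp: functorially_finite_def)
  then show ?thesis
    using subcategory_op[OF subcat] left_perp right_perp X_subset enough_proj enough_inj
      proj_subset inj_subset zero_mod_X
    by unfold_locales simp_all
qed

lemma cong_add_factoring: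
  assumes "f \<in> arr S A B" "k \<in> factoring S X A B"
  shows "cong_mod S X A B (f \<otimes>\<^bsub>Hom S A B\<^esub> k) f"
  using assms add_comm[OF assms(1) factoring_arr[OF assms(2)]] add_arr[OF assms(1) factoring_arr[OF assms(2)]]
  by (auto simp: cong_mod_def)

text \<open>
  A conflation whose third term \<open>Z\<close> is isomorphic to \<open>C\<close> only modulo \<open>X\<close> can be corrected to one ending
  in \<open>C\<close> itself. The inverse of the isomorphism extends to a split deflation \<open>W = Z \<oplus> Y' \<rightarrow> C\<close> with
  \<open>Y' \<in> X\<close>, whose kernel \<open>K\<close> vanishes modulo \<open>X\<close> and hence lies in \<open>X\<close>. Adding \<open>Y'\<close> to the given
  conflation and restricting along \<open>C \<rightarrow> W\<close> then only splits off \<open>K\<close> from the middle term.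
\<close>

lemma conflation_transfer:
  assumes U: "subcategory S U" "X \<subseteq> U"
    and t: "etriangle S A x B y Z \<delta>" and A: "A \<in> \<A>" and B: "B \<in> U" and C: "C \<in> \<A>"
    and f: "f \<in> arr S C Z" and g: "g \<in> arr S Z C"
    and gf: "cong_mod S X C C (g \<cdot> f) (Idn S C)" and fg: "cong_mod S X Z Z (f \<cdot> g) (Idn S Z)"
  obtains E e d \<epsilon> where "E \<in> U" "etriangle S A e E d C \<epsilon>"
proof -
  note T = etriangleD[OF t] and C_obj = perp_obj[OF C]
  note iC = id_arr[OF C_obj]
  \<comment> \<open>\<open>1 = v u + g f\<close> with \<open>v : Y \<rightarrow> C\<close>, which becomes a deflation after adding a projective to \<open>Y\<close>\<close>
  obtain k where k: "k \<in> factoring S X C C" "Idn S C = k \<otimes>\<^bsub>Hom S C C\<^esub> (g \<cdot> f)"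
    using cong_sym[OF gf] by (auto simp: cong_mod_def)
  obtain Y u v where Y: "Y \<in> X" "u \<in> arr S C Y" "v \<in> arr S Y C" "k = v \<cdot> u"
    using k(1) by (rule factoringE)
  obtain K0 x0 P y0 \<delta>0 where P: "P \<in> X" and tP: "etriangle S K0 x0 P y0 C \<delta>0"
    using enough_proj C_obj proj_subset unfolding enough_projectives_def by blast
  obtain Y' i1 j1 p1 q1 where b1: "biproduct S Y P Y' i1 j1 p1 q1"
    using has_direct_sums[OF subcat_obj[OF Y(1)] subcat_obj[OF P]] unfolding direct_sum_def by blast
  have Y': "Y' \<in> X"
    using subcat_sum[OF Y(1) P] b1 unfolding direct_sum_def by blast
  define y' where "y' = (v \<cdot> p1) \<otimes>\<^bsub>Hom S Y' C\<^esub> (y0 \<cdot> q1)"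
  note y' = biproduct_copair[OF b1 Y(3) etriangleD(2)[OF tP], folded y'_def]
  obtain K1 x1 \<delta>1 where t1: "etriangle S K1 x1 Y' y' C \<delta>1"
    using deflation_copair[OF tP b1 Y(3)] unfolding y'_def by blast
  obtain W i j p q where b: "biproduct S Z Y' W i j p q"
    using has_direct_sums[OF T(6) subcat_obj[OF Y']] unfolding direct_sum_def by blast
  note W = biproductD[OF b]
  define w where "w = (g \<cdot> p) \<otimes>\<^bsub>Hom S W C\<^esub> (y' \<cdot> q)"
  note w = biproduct_copair[OF b g y'(1), folded w_def]
  obtain K \<kappa> \<delta>K where tK: "etriangle S K \<kappa> W w C \<delta>K"
    using deflation_copair[OF t1 b g] unfolding w_def by blast
  note TK = etriangleD[OF tK]
  have i1u: "i1 \<cdot> u \<in> arr S C Y'"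
    using comp_arr[OF Y(2) biproductD(1)[OF b1]] .
  note if_arr = comp_arr[OF f W(1)] and ju = comp_arr[OF i1u W(2)]
  \<comment> \<open>a section of \<open>w\<close>\<close>
  define s where "s = (i \<cdot> f) \<otimes>\<^bsub>Hom S C W\<^esub> (j \<cdot> (i1 \<cdot> u))"
  have s: "s \<in> arr S C W"
    unfolding s_def by (rule add_arr[OF if_arr ju])
  have "w \<cdot> s = (w \<cdot> (i \<cdot> f)) \<otimes>\<^bsub>Hom S C C\<^esub> (w \<cdot> (j \<cdot> (i1 \<cdot> u)))"
    unfolding s_def using add_comp[OF if_arr ju w(1)] .
  also have "w \<cdot> (i \<cdot> f) = g \<cdot> f"
    using comp_assoc[OF f W(1) w(1)] w(2) by simp
  also have "w \<cdot> (j \<cdot> (i1 \<cdot> u)) = k"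
    using comp_assoc[OF i1u W(2) w(1)] w(3) comp_assoc[OF Y(2) biproductD(1)[OF b1] y'(1)] y'(2) Y(4)
    by simp
  also have "(g \<cdot> f) \<otimes>\<^bsub>Hom S C C\<^esub> k = Idn S C"
    using k(2) add_comm[OF comp_arr[OF f g] factoring_arr[OF k(1)]] by simp
  finally have ws: "w \<cdot> s = Idn S C" .
  have "\<delta>K = Pull S s K (Pull S w K \<delta>K)"
    using pull_id[OF TK(3)] pull_comp[OF TK(3) w(1) s] ws by simp
  also have "\<dots> = \<one>\<^bsub>Ext S C K\<^esub>"
    using pull_deflation[OF tK] pull_null[OF TK(4) s] by simp
  finally obtain l r where bK: "biproduct S K C W \<kappa> l r w"
    using split_etriangle tK by metis
  note BK = biproductD[OF bK]
  have "K \<in> X"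
  proof (rule zero_mod_X[OF TK(4)])
    \<comment> \<open>modulo \<open>X\<close>, \<open>i f\<close> is inverse to \<open>w\<close>, so \<open>w \<kappa> = 0\<close> makes the split monomorphism \<open>\<kappa>\<close> vanish\<close>
    have fact: "y \<cdot> q \<in> factoring S X W D" if "y \<in> arr S Y' D" for y D
      using factoringI[OF Y' W(4) that] .
    have ifg: "(i \<cdot> f) \<cdot> g = i \<cdot> (f \<cdot> g)"
      using comp_assoc[OF g f W(1)] by simp
    have "(i \<cdot> f) \<cdot> w = ((i \<cdot> f) \<cdot> (g \<cdot> p)) \<otimes>\<^bsub>Hom S W W\<^esub> ((i \<cdot> f) \<cdot> (y' \<cdot> q))"
      unfolding w_def using add_comp[OF comp_arr[OF W(3) g] comp_arr[OF W(4) y'(1)] if_arr] .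
    then have "cong_mod S X W W ((i \<cdot> f) \<cdot> w) ((i \<cdot> f) \<cdot> (g \<cdot> p))"
      using cong_add_factoring[OF comp_arr[OF comp_arr[OF W(3) g] if_arr]]
        comp_factoring[OF fact[OF y'(1)] if_arr] by simp
    moreover have "cong_mod S X W W ((i \<cdot> f) \<cdot> (g \<cdot> p)) (i \<cdot> p)"
      using cong_comp_right[OF cong_comp_left[OF fg W(1)] W(3)] comp_assoc[OF W(3) g if_arr]
        ifg id_right[OF W(1)] by simp
    moreover have "cong_mod S X W W (i \<cdot> p) (Idn S W)"
      using cong_sym[OF cong_add_factoring[OF comp_arr[OF W(3,1)] fact[OF W(2)]]] W(9) by simp
    ultimately have "cong_mod S X W W ((i \<cdot> f) \<cdot> w) (Idn S W)"
      using cong_trans by blast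
    then have "cong_mod S X K K (r \<cdot> (((i \<cdot> f) \<cdot> w) \<cdot> \<kappa>)) (r \<cdot> (Idn S W \<cdot> \<kappa>))"
      by (rule cong_comp_left[OF cong_comp_right[OF _ BK(1)] BK(3)])
    moreover have "r \<cdot> (((i \<cdot> f) \<cdot> w) \<cdot> \<kappa>) = \<one>\<^bsub>Hom S K K\<^esub>"
      using comp_assoc[OF BK(1) w(1) if_arr] BK(7) comp_null_right[OF if_arr TK(4)]
        comp_null_right[OF BK(3) TK(4)] by simp
    moreover have "r \<cdot> (Idn S W \<cdot> \<kappa>) = Idn S K"
      using id_left[OF BK(1)] BK(5) by simp
    ultimately show "Idn S K \<in> factoring S X K K"
      using cong_null_iff[OF id_arr[OF TK(4)]] cong_sym by metis
  qed
  \<comment> \<open>composing \<open>B \<oplus> Y' \<rightarrow> W\<close> with the projection \<open>W \<rightarrow> K\<close> restricts the conflation to \<open>C\<close>\<close>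
  note tC = etriangle_split[OF biproduct_swap[OF bK]]
  obtain B' iB jB pB qB where bB: "biproduct S B Y' B' iB jB pB qB"
    using has_direct_sums[OF T(5) subcat_obj[OF Y']] unfolding direct_sum_def by blast
  have "B' \<in> U"
    using subcategoryD(4)[OF U(1) B] Y' U(2) bB unfolding direct_sum_def by blast
  obtain E h' d e \<eta> \<epsilon> h where E: "etriangle S E h' B' h K \<eta>" "etriangle S A e E d C \<epsilon>"
    using ET4_op[OF tC etriangle_add_object[OF t bB b]] by blast
  have "E \<in> \<A>"
    using perp_extension[OF E(2) A C] .
  then have "\<eta> = \<one>\<^bsub>Ext S K E\<^esub>"
    using ext_trivialD[OF perp_trivial(2)[OF _ \<open>K \<in> X\<close>] etriangleD(3)[OF E(1)]] by blast
  then have "direct_sum S E K B'"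
    using etriangle_direct_sum E(1) by metis
  then have "E \<in> U"
    using subcategoryD(5)[OF U(1) \<open>B' \<in> U\<close>] by blast
  then show thesis
    using that E(2) by blast
qed

text \<open>
  Approximating conflations for objects of \<open>\<A>\<close> yield such conflations for all objects \<open>C\<close>: there is a
  conflation \<open>X\<^sub>1 \<rightarrow> B \<rightarrow> C\<close> with \<open>X\<^sub>1 \<in> X\<close> and \<open>B \<in> \<A>\<close>, the pushout of a projective presentation of \<open>C\<close>
  along a left \<open>X\<close>-approximation of its kernel.
\<close>

lemma precover_extend:
  assumes V: "subcategory S V" "X \<subseteq> V" "V \<subseteq> \<A>"
    and ex: "\<And>D. D \<in> \<A> \<Longrightarrow> \<exists>V0 x U0 y \<delta>. V0 \<in> V \<and> U0 \<in> U \<and> etriangle S V0 x U0 y D \<delta>"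
    and C: "C \<in> Obj S"
  shows "\<exists>V0 x U0 y \<delta>. V0 \<in> V \<and> U0 \<in> U \<and> etriangle S V0 x U0 y C \<delta>"
proof -
  obtain K k P p \<delta> where P: "P \<in> X" and tP: "etriangle S K k P p C \<delta>"
    using enough_proj C proj_subset unfolding enough_projectives_def by blast
  note TP = etriangleD[OF tP]
  obtain X1 l where l: "left_approx S X K X1 l"
    using ff TP(4) unfolding functorially_finite_def by blast
  then have X1: "X1 \<in> X" and l_arr: "l \<in> arr S K X1"
    by (auto simp: left_approx_def)
  obtain B b c where tB: "etriangle S X1 b B c C (Push S C l \<delta>)"
    using etriangle_exists[OF push_ext[OF TP(3) l_arr]] by blast
  note TB = etriangleD[OF tB]
  \<comment> \<open>an extension of \<open>B\<close> by \<open>Y\<close> comes from \<open>\<bbbE>(C, Y)\<close>, and every element of \<open>\<bbbE>(C, Y)\<close> is a pushout of \<open>l\<^sub>* \<delta>\<close>\<close>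
  have "ext_trivial S B Y" if Y: "Y \<in> X" for Y
  proof (rule ext_trivialI)
    fix \<epsilon> assume \<epsilon>: "\<epsilon> \<in> exts S B Y"
    have "ext_trivial S X1 Y" "ext_trivial S P Y"
      using perp_trivial(1)[OF _ Y] X1 P X_subset by blast+
    then obtain \<zeta> where \<zeta>: "\<zeta> \<in> exts S C Y" "Pull S c Y \<zeta> = \<epsilon>"
      using pull_inflation_kernel[OF tB \<epsilon> ext_trivialD[OF _ pull_ext[OF \<epsilon> TB(1)]]] by blast
    obtain n where n: "n \<in> arr S K Y" "Push S C n \<delta> = \<zeta>"
      using pull_deflation_kernel[OF tP \<zeta>(1) ext_trivialD[OF \<open>ext_trivial S P Y\<close> pull_ext[OF \<zeta>(1) TP(2)]]]
      by blast
    obtain m where m: "m \<in> arr S X1 Y" "n = m \<cdot> l"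
      using l Y n(1) unfolding left_approx_def by blast
    have "\<epsilon> = Pull S c Y (Push S C m (Push S C l \<delta>))"
      using push_comp[OF TP(3) l_arr m(1)] m(2) n(2) \<zeta>(2) by simp
    also have "\<dots> = Push S B m (Pull S c X1 (Push S C l \<delta>))"
      using push_pull[OF TB(3) m(1) TB(2)] by simp
    also have "\<dots> = \<one>\<^bsub>Ext S B Y\<^esub>"
      using pull_deflation[OF tB] push_null[OF TB(5) m(1)] by simp
    finally show "\<epsilon> = \<one>\<^bsub>Ext S B Y\<^esub>" .
  qed
  then have "B \<in> \<A>"
    using perp_iff(1) TB(5) by blast
  then obtain V1 x U1 y \<eta> where V1: "V1 \<in> V" "U1 \<in> U" and tV: "etriangle S V1 x U1 y B \<eta>"
    using ex by blast
  \<comment> \<open>the kernel \<open>E\<close> of \<open>U1 \<rightarrow> B \<rightarrow> C\<close> is an extension of \<open>X1\<close> by \<open>V1\<close>, and such extensions split\<close>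
  obtain E h' h \<epsilon> e d \<zeta> where E: "etriangle S E h' U1 h C \<epsilon>" "etriangle S V1 e E d X1 \<zeta>"
    using ET4_op[OF tB tV] by blast
  have "\<zeta> = \<one>\<^bsub>Ext S X1 V1\<^esub>"
    using ext_trivialD[OF perp_trivial(2)[OF _ X1] etriangleD(3)[OF E(2)]] V(3) V1(1) by blast
  then have "direct_sum S V1 X1 E"
    using etriangle_direct_sum E(2) by metis
  then have "E \<in> V"
    using subcategoryD(4)[OF V(1) V1(1)] X1 V(2) by blast
  then show ?thesis
    using E(1) V1(2) by blast
qed

text \<open>
  Conflations that end or begin in the right object up to isomorphism modulo \<open>X\<close> suffice; the two
  versions are dual to each other, with \<open>U\<close> and \<open>V\<close> exchanged.
\<close>

lemma precover_from_quotient: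
  assumes U: "subcategory S U" "X \<subseteq> U" and V: "subcategory S V" "X \<subseteq> V" "V \<subseteq> \<A>"
    and ex: "\<And>D. D \<in> \<A> \<Longrightarrow> \<exists>A x B y Z \<delta> f g. A \<in> V \<and> B \<in> U \<and> etriangle S A x B y Z \<delta> \<and>
      f \<in> arr S D Z \<and> g \<in> arr S Z D \<and>
      cong_mod S X D D (g \<cdot> f) (Idn S D) \<and> cong_mod S X Z Z (f \<cdot> g) (Idn S Z)"
    and C: "C \<in> Obj S"
  shows "\<exists>V0 x U0 y \<delta>. V0 \<in> V \<and> U0 \<in> U \<and> etriangle S V0 x U0 y C \<delta>"
proof (rule precover_extend[OF V _ C])
  fix D assume D: "D \<in> \<A>"
  obtain A x B y Z \<delta> f g where *: "A \<in> V" "B \<in> U" "etriangle S A x B y Z \<delta>" "f \<in> arr S D Z"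
    "g \<in> arr S Z D" "cong_mod S X D D (g \<cdot> f) (Idn S D)" "cong_mod S X Z Z (f \<cdot> g) (Idn S Z)"
    using ex[OF D] by blast
  have "A \<in> \<A>"
    using *(1) V(3) by blast
  then show "\<exists>V0 x U0 y \<delta>. V0 \<in> V \<and> U0 \<in> U \<and> etriangle S V0 x U0 y D \<delta>"
    using conflation_transfer[OF U *(3) _ *(2) D *(4-7)] *(1) by metis
qed

lemma preenvelope_from_quotient:
  assumes "subcategory S U" "X \<subseteq> U" "U \<subseteq> \<A>" and "subcategory S V" "X \<subseteq> V"
    and ex: "\<And>D. D \<in> \<A> \<Longrightarrow> \<exists>A x B y Z \<delta> f g. B \<in> V \<and> Z \<in> U \<and> etriangle S A x B y Z \<delta> \<and>
      f \<in> arr S D A \<and> g \<in> arr S A D \<and>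
      cong_mod S X D D (g \<cdot> f) (Idn S D) \<and> cong_mod S X A A (f \<cdot> g) (Idn S A)"
    and "C \<in> Obj S"
  shows "\<exists>x V1 y U1 \<delta>. V1 \<in> V \<and> U1 \<in> U \<and> etriangle S C x V1 y U1 \<delta>"
proof -
  have "\<exists>V0 x U0 y \<delta>. V0 \<in> U \<and> U0 \<in> V \<and> etriangle (op_ext S) V0 x U0 y C \<delta>"
  proof (rule rigid_subcategory.precover_from_quotient[OF rigid_subcategory_op])
    fix D assume "D \<in> \<A>"
    from ex[OF this] show "\<exists>A x B y Z \<delta> f g. A \<in> U \<and> B \<in> V \<and> etriangle (op_ext S) A x B y Z \<delta> \<and>
      f \<in> arr (op_ext S) D Z \<and> g \<in> arr (op_ext S) Z D \<and>
      cong_mod (op_ext S) X D D (g \<cdot>\<^bsub>op_ext S\<^esub> f) (Idn (op_ext S) D) \<and>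
      cong_mod (op_ext S) X Z Z (f \<cdot>\<^bsub>op_ext S\<^esub> g) (Idn (op_ext S) Z)"
      unfolding op_ext_simps arr_op cong_mod_op etriangle_op by blast
  qed (use assms subcategory_op in auto)
  then show ?thesis
    unfolding etriangle_op by blast
qed

text \<open>
  If the identity of \<open>D\<close> is modulo \<open>X\<close> a sum of two morphisms factoring through \<open>T\<close> and \<open>T'\<close>, then
  \<open>\<bbbE>(D, v)\<close> vanishes as soon as \<open>\<bbbE>(T, v)\<close> and \<open>\<bbbE>(T', v)\<close> do, because \<open>\<bbbE>(-, v)\<close> kills \<open>X\<close> for \<open>v \<in> \<A>\<close>.
\<close>

lemma ext_trivial_left_mod_X:
  assumes id: "cong_mod S X D D ((b \<cdot> a) \<otimes>\<^bsub>Hom S D D\<^esub> (b' \<cdot> a')) (Idn S D)"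
    and a: "a \<in> arr S D T" "b \<in> arr S T D" and a': "a' \<in> arr S D T'" "b' \<in> arr S T' D"
    and v: "v \<in> \<A>" "ext_trivial S T v" "ext_trivial S T' v"
  shows "ext_trivial S D v"
proof (rule ext_trivialI)
  fix \<epsilon> assume \<epsilon>: "\<epsilon> \<in> exts S D v"
  have kill: "Pull S (b \<cdot> a) v \<epsilon> = \<one>\<^bsub>Ext S D v\<^esub>"
    if "a \<in> arr S D T" "b \<in> arr S T D" "ext_trivial S T v" for a b T
    using pull_comp[OF \<epsilon> that(2,1)] ext_trivialD[OF that(3) pull_ext[OF \<epsilon> that(2)]]
      pull_null[OF extsD(2)[OF \<epsilon>] that(1)] by simp
  note ba = comp_arr[OF a] and ba' = comp_arr[OF a']
  obtain k where k: "k \<in> factoring S X D D"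
    "Idn S D = k \<otimes>\<^bsub>Hom S D D\<^esub> ((b \<cdot> a) \<otimes>\<^bsub>Hom S D D\<^esub> (b' \<cdot> a'))"
    using cong_sym[OF id] by (auto simp: cong_mod_def)
  have "Pull S k v \<epsilon> = \<one>\<^bsub>Ext S D v\<^esub>"
    using k(1)
  proof (rule factoringE)
    fix Y s t assume "Y \<in> X" "s \<in> arr S D Y" "t \<in> arr S Y D" "k = t \<cdot> s"
    then show ?thesis
      using kill perp_trivial(2)[OF v(1)] by simp
  qed
  then have "Pull S (Idn S D) v \<epsilon> =
      \<one>\<^bsub>Ext S D v\<^esub> \<otimes>\<^bsub>Ext S D v\<^esub> (\<one>\<^bsub>Ext S D v\<^esub> \<otimes>\<^bsub>Ext S D v\<^esub> \<one>\<^bsub>Ext S D v\<^esub>)"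
    unfolding k(2) using pull_add[OF \<epsilon> factoring_arr[OF k(1)] add_arr[OF ba ba']] pull_add[OF \<epsilon> ba ba']
      kill[OF a v(2)] kill[OF a' v(3)] by simp
  then show "\<epsilon> = \<one>\<^bsub>Ext S D v\<^esub>"
    using pull_id[OF \<epsilon>] ext_group[OF extsD(1,2)[OF \<epsilon>]] by (simp add: comm_group_def group.is_monoid)
qed

lemma ext_trivial_right_mod_X:
  assumes "cong_mod S X D D ((b \<cdot> a) \<otimes>\<^bsub>Hom S D D\<^esub> (b' \<cdot> a')) (Idn S D)"
    and "a \<in> arr S D T" "b \<in> arr S T D" "a' \<in> arr S D T'" "b' \<in> arr S T' D"
    and "v \<in> \<A>" "ext_trivial S v T" "ext_trivial S v T'"
  shows "ext_trivial S v D"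
  using rigid_subcategory.ext_trivial_left_mod_X[OF rigid_subcategory_op, of D a b a' b' T T' v] assms
  by simp

end

context extriangulated_category
begin

lemma cotorsion_pairD:
  assumes "cotorsion_pair S U V"
  shows "subcategory S U" "subcategory S V" "\<lbrakk>u \<in> U; v \<in> V\<rbrakk> \<Longrightarrow> ext_trivial S u v"
    "C \<in> Obj S \<Longrightarrow> \<exists>V0 x U0 y \<delta>. V0 \<in> V \<and> U0 \<in> U \<and> etriangle S V0 x U0 y C \<delta>"
    "C \<in> Obj S \<Longrightarrow> \<exists>x V1 y U1 \<delta>. V1 \<in> V \<and> U1 \<in> U \<and> etriangle S C x V1 y U1 \<delta>"
proof -
  show U: "subcategory S U" and V: "subcategory S V"
    using assms by (simp_all add: cotorsion_pair_def)
  show "ext_trivial S u v" if "u \<in> U" "v \<in> V"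
    using assms that ext_vanishes_iff[OF subcategoryD(1)[OF U] subcategoryD(1)[OF V]]
    by (simp add: cotorsion_pair_def)
  show "C \<in> Obj S \<Longrightarrow> \<exists>V0 x U0 y \<delta>. V0 \<in> V \<and> U0 \<in> U \<and> etriangle S V0 x U0 y C \<delta>"
    "C \<in> Obj S \<Longrightarrow> \<exists>x V1 y U1 \<delta>. V1 \<in> V \<and> U1 \<in> U \<and> etriangle S C x V1 y U1 \<delta>"
    using assms unfolding cotorsion_pair_def by blast+
qed

lemma cotorsion_pair_left_perp:
  assumes cp: "cotorsion_pair S U V" and D: "D \<in> Obj S" "\<And>v. v \<in> V \<Longrightarrow> ext_trivial S D v"
  shows "D \<in> U"
proof -
  obtain V0 x U0 y \<delta> where *: "V0 \<in> V" "U0 \<in> U" "etriangle S V0 x U0 y D \<delta>"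
    using cotorsion_pairD(4)[OF cp D(1)] by blast
  then have "\<delta> = \<one>\<^bsub>Ext S D V0\<^esub>"
    using ext_trivialD[OF D(2) etriangleD(3)] by blast
  then show ?thesis
    using subcategoryD(6)[OF cotorsion_pairD(1)[OF cp] *(2)] etriangle_direct_sum *(3) by metis
qed

lemma cotorsion_pair_right_perp:
  assumes cp: "cotorsion_pair S U V" and D: "D \<in> Obj S" "\<And>u. u \<in> U \<Longrightarrow> ext_trivial S u D"
  shows "D \<in> V"
proof -
  obtain x V1 y U1 \<delta> where *: "V1 \<in> V" "U1 \<in> U" "etriangle S D x V1 y U1 \<delta>"
    using cotorsion_pairD(5)[OF cp D(1)] by blast
  then have "\<delta> = \<one>\<^bsub>Ext S U1 D\<^esub>"
    using ext_trivialD[OF D(2) etriangleD(3)] by blast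
  then show ?thesis
    using subcategoryD(5)[OF cotorsion_pairD(2)[OF cp] *(1)] etriangle_direct_sum *(3) by metis
qed

end

section \<open>The quotient category\<close>

text \<open>
  In the following, \<open>Q\<close> is the quotient \<open>\<A>/X\<close>, \<open>cl f\<close> is the class of \<open>f\<close>, and
  \<open>A \<rightarrow> Mid A \<rightarrow> Sh A\<close> with morphisms \<open>In A\<close>, \<open>Out A\<close> is the chosen conflation, realizing \<open>Sx A\<close>,
  where \<open>Sh A = A\<langle>1\<rangle>\<close>.
\<close>

locale rigid_subcategory_with_shift = rigid_subcategory S X \<A>
  for S :: "('o, 'm, 'e, 'z) ext_data_scheme" (structure) and X \<A> :: "'o set" +
  fixes c :: "('o, 'm, 'e) shift_choice"
  assumes shift_choice: "valid_shift_choice S \<A> X c"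
begin

abbreviation Q :: "('o, 'm set) cat_data" where
  "Q \<equiv> quotient_category (full_subcategory S \<A>) X"

abbreviation cl :: "'m \<Rightarrow> 'm set" where
  "cl \<equiv> mor_class (full_subcategory S \<A>) X"

abbreviation "In \<equiv> chIn c"
abbreviation "Mid \<equiv> chMid c"
abbreviation "Out \<equiv> chOut c"
abbreviation "Sh \<equiv> chShift c"
abbreviation "Sx \<equiv> chExt c"

lemma shiftD:
  assumes "A \<in> \<A>"
  shows "Sh A \<in> \<A>" "etriangle S A (In A) (Mid A) (Out A) (Sh A) (Sx A)"
    "left_approx S X A (Mid A) (In A)" "right_approx S X (Mid A) (Sh A) (Out A)" "Mid A \<in> X"
  using shift_choice assms by (auto simp: valid_shift_choice_def left_approx_def)

lemma arr_full:
  assumes "A \<in> \<A>" "B \<in> \<A>"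
  shows "arr (full_subcategory S \<A>) A B = arr S A B"
  using assms perp_obj by (auto simp: arr_def full_subcategory_def)

lemma factoring_full:
  assumes "A \<in> \<A>" "B \<in> \<A>"
  shows "factoring (full_subcategory S \<A>) X A B = factoring S X A B"
  using assms X_subset arr_full unfolding factoring_def by (auto simp: full_subcategory_def subset_iff)

lemma Q_simps:
  "Obj Q = \<A>" "Idn Q A = cl (Idn S A)"
  by (simp_all add: quotient_category_def full_subcategory_def)

lemma Q_null:
  assumes "A \<in> \<A>" "B \<in> \<A>"
  shows "\<one>\<^bsub>Hom Q A B\<^esub> = factoring S X A B"
  using factoring_full[OF assms] by (simp add: quotient_category_def full_subcategory_def)

lemma cl_coset:
  assumes "A \<in> \<A>" "B \<in> \<A>" "f \<in> arr S A B"
  shows "cl f = factoring S X A B #>\<^bsub>Hom S A B\<^esub> f"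
proof -
  have "A' = A \<and> B' = B" if "f \<in> arr (full_subcategory S \<A>) A' B'" for A' B'
  proof -
    have "f \<in> arr S A' B'"
      using that perp_obj by (auto simp: arr_def full_subcategory_def)
    then show ?thesis
      using hom_disjoint assms(3) by blast
  qed
  moreover have "f \<in> arr (full_subcategory S \<A>) A B"
    using assms arr_full by simp
  ultimately have "cl f = {h. h \<in> factoring (full_subcategory S \<A>) X A B #>\<^bsub>Hom (full_subcategory S \<A>) A B\<^esub> f}"
    unfolding mor_class_def by (intro Collect_cong) metis
  then show ?thesis
    using factoring_full[OF assms(1,2)] by (simp add: full_subcategory_def)
qed

lemma cl_eq_iff:
  assumes "A \<in> \<A>" "B \<in> \<A>" "f \<in> arr S A B" "g \<in> arr S A B"
  shows "cl f = cl g \<longleftrightarrow> cong_mod S X A B f g"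
  using cl_coset[OF assms(1,2)] assms(3,4) cong_iff_coset_eq by simp

lemma mem_cl_iff:
  assumes "A \<in> \<A>" "B \<in> \<A>" "f \<in> arr S A B"
  shows "h \<in> cl f \<longleftrightarrow> cong_mod S X A B h f"
proof -
  have "h \<in> cl f \<longleftrightarrow> (\<exists>k \<in> factoring S X A B. h = k \<otimes>\<^bsub>Hom S A B\<^esub> f)"
    unfolding cl_coset[OF assms] r_coset_def by blast
  also have "\<dots> \<longleftrightarrow> cong_mod S X A B h f"
    unfolding cong_mod_def using assms(3) add_arr[OF factoring_arr assms(3)] by metis
  finally show ?thesis .
qed

lemma arr_Q:
  "\<phi> \<in> arr Q A B \<longleftrightarrow> A \<in> \<A> \<and> B \<in> \<A> \<and> (\<exists>f \<in> arr S A B. \<phi> = cl f)"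
proof (cases "A \<in> \<A> \<and> B \<in> \<A>")
  case True
  then have "carrier (Hom Q A B) = (\<lambda>f. factoring S X A B #>\<^bsub>Hom S A B\<^esub> f) ` carrier (Hom S A B)"
    using factoring_full by (simp add: quotient_category_def full_subcategory_def carrier_FactGroup)
  also have "carrier (Hom S A B) = arr S A B"
    using True perp_obj by (auto simp: arr_def)
  also have "(\<lambda>f. factoring S X A B #>\<^bsub>Hom S A B\<^esub> f) ` arr S A B = cl ` arr S A B"
    by (intro image_cong refl cl_coset[symmetric]) (use True in simp_all)
  finally have "arr Q A B = cl ` arr S A B"
    unfolding arr_def[of Q] Q_simps using True by simp
  then show ?thesis
    using True by blast
next
  case False
  then show ?thesis
    unfolding arr_def[of Q] Q_simps by blast
qed

lemma cl_arr: "\<lbrakk>A \<in> \<A>; B \<in> \<A>; f \<in> arr S A B\<rbrakk> \<Longrightarrow> cl f \<in> arr Q A B"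
  by (auto simp: arr_Q)

lemma cl_comp:
  assumes "A \<in> \<A>" "B \<in> \<A>" "D \<in> \<A>" "f \<in> arr S A B" "g \<in> arr S B D"
  shows "cl g \<cdot>\<^bsub>Q\<^esub> cl f = cl (g \<cdot> f)"
proof -
  have "cl (g' \<cdot> f') = cl (g \<cdot> f)" if "f' \<in> cl f" "g' \<in> cl g" for f' g'
  proof -
    have c: "cong_mod S X A B f' f" "cong_mod S X B D g' g"
      using that mem_cl_iff[OF assms(1,2,4)] mem_cl_iff[OF assms(2,3,5)] by simp_all
    show ?thesis
      using cl_eq_iff[OF assms(1,3) cong_modD[OF cong_comp[OF c]]] cong_comp[OF c] by simp
  qed
  moreover have "f \<in> cl f" "g \<in> cl g"
    using mem_cl_iff[OF assms(1,2,4)] mem_cl_iff[OF assms(2,3,5)] cong_refl assms(4,5) by simp_all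
  ultimately have "(\<Union>g' \<in> cl g. \<Union>f' \<in> cl f. cl (g' \<cdot> f')) = cl (g \<cdot> f)"
    by blast
  then show ?thesis
    by (simp add: quotient_category_def full_subcategory_def)
qed

lemma cl_add:
  assumes "A \<in> \<A>" "B \<in> \<A>" "f \<in> arr S A B" "g \<in> arr S A B"
  shows "cl f \<otimes>\<^bsub>Hom Q A B\<^esub> cl g = cl (f \<otimes>\<^bsub>Hom S A B\<^esub> g)"
proof -
  have "factoring S X A B \<lhd> Hom S A B"
    by (intro comm_group.subgroup_imp_normal hom_group factoring_subgroup perp_obj assms(1,2))
  from normal.rcos_sum[OF this arrD(3)[OF assms(3)] arrD(3)[OF assms(4)]] show ?thesis
    using cl_coset[OF assms(1,2,3)] cl_coset[OF assms(1,2,4)]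
      cl_coset[OF assms(1,2) add_arr[OF assms(3,4)]] factoring_full[OF assms(1,2)]
    by (simp add: quotient_category_def full_subcategory_def)
qed

lemma Q_isoE:
  assumes "is_iso Q A B \<phi>"
  obtains f g where "A \<in> \<A>" "B \<in> \<A>" "f \<in> arr S A B" "g \<in> arr S B A"
    "cong_mod S X A A (g \<cdot> f) (Idn S A)" "cong_mod S X B B (f \<cdot> g) (Idn S B)"
proof -
  obtain \<psi> where \<psi>: "\<phi> \<in> arr Q A B" "\<psi> \<in> arr Q B A" "\<psi> \<cdot>\<^bsub>Q\<^esub> \<phi> = Idn Q A" "\<phi> \<cdot>\<^bsub>Q\<^esub> \<psi> = Idn Q B"
    using assms unfolding is_iso_def by blast
  obtain f g where f: "A \<in> \<A>" "B \<in> \<A>" "f \<in> arr S A B" "\<phi> = cl f" and g: "g \<in> arr S B A" "\<psi> = cl g"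
    using \<psi>(1,2) unfolding arr_Q by blast
  have "cl (g \<cdot> f) = cl (Idn S A)" "cl (f \<cdot> g) = cl (Idn S B)"
    using \<psi>(3,4) f(4) g(2) cl_comp[OF f(1,2,1,3) g(1)] cl_comp[OF f(2,1,2) g(1) f(3)] Q_simps by simp_all
  then show thesis
    using that[OF f(1-3) g(1)] cl_eq_iff[OF f(1,1) comp_arr[OF f(3) g(1)] id_arr[OF perp_obj[OF f(1)]]]
      cl_eq_iff[OF f(2,2) comp_arr[OF g(1) f(3)] id_arr[OF perp_obj[OF f(2)]]] by simp
qed

lemma Q_identity_iso:
  assumes "A \<in> \<A>"
  shows "is_iso Q A A (cl (Idn S A))"
proof -
  note i = id_arr[OF perp_obj[OF assms]]
  show ?thesis
    unfolding is_iso_def Q_simps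
    using cl_arr[OF assms assms i] cl_comp[OF assms assms assms i i] id_left[OF i]
    by (intro conjI bexI[of _ "cl (Idn S A)"]) simp_all
qed

lemma Q_zero_object:
  assumes "zero_object Q Z"
  shows "Z \<in> \<A>" "cong_mod S X Z Z (Idn S Z) \<one>\<^bsub>Hom S Z Z\<^esub>"
proof -
  show Z: "Z \<in> \<A>"
    using assms unfolding zero_object_def Q_simps by blast
  note i = id_arr[OF perp_obj[OF Z]] and n = null_arr[OF perp_obj[OF Z] perp_obj[OF Z]]
  have "\<exists>!\<phi>. \<phi> \<in> arr Q Z Z"
    using assms Z unfolding zero_object_def Q_simps by blast
  then have "cl (Idn S Z) = cl \<one>\<^bsub>Hom S Z Z\<^esub>"
    using cl_arr[OF Z Z i] cl_arr[OF Z Z n] by blast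
  then show "cong_mod S X Z Z (Idn S Z) \<one>\<^bsub>Hom S Z Z\<^esub>"
    using cl_eq_iff[OF Z Z i n] by simp
qed

lemma Q_direct_sumE:
  assumes "direct_sum Q A B D"
  obtains i j p q where "A \<in> \<A>" "B \<in> \<A>" "D \<in> \<A>"
    "i \<in> arr S A D" "j \<in> arr S B D" "p \<in> arr S D A" "q \<in> arr S D B"
    "cong_mod S X A A (p \<cdot> i) (Idn S A)" "cong_mod S X B B (q \<cdot> j) (Idn S B)"
    "cong_mod S X D D ((i \<cdot> p) \<otimes>\<^bsub>Hom S D D\<^esub> (j \<cdot> q)) (Idn S D)"
proof -
  obtain \<iota> \<iota>' \<pi> \<pi>' where b: "biproduct Q A B D \<iota> \<iota>' \<pi> \<pi>'"
    using assms unfolding direct_sum_def by blast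
  note B = biproductD[OF b]
  obtain i j p q where f: "A \<in> \<A>" "B \<in> \<A>" "D \<in> \<A>"
    "i \<in> arr S A D" "j \<in> arr S B D" "p \<in> arr S D A" "q \<in> arr S D B"
    "\<iota> = cl i" "\<iota>' = cl j" "\<pi> = cl p" "\<pi>' = cl q"
    using B(1-4) unfolding arr_Q by blast
  note ip = comp_arr[OF f(6,4)] and jq = comp_arr[OF f(7,5)]
    and pi = comp_arr[OF f(4,6)] and qj = comp_arr[OF f(5,7)]
  have "cl (p \<cdot> i) = cl (Idn S A)" "cl (q \<cdot> j) = cl (Idn S B)"
    "cl ((i \<cdot> p) \<otimes>\<^bsub>Hom S D D\<^esub> (j \<cdot> q)) = cl (Idn S D)"
    using B(5,6,9) f(8-11) cl_comp[OF f(1,3,1,4,6)] cl_comp[OF f(2,3,2,5,7)]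
      cl_comp[OF f(3,1,3,6,4)] cl_comp[OF f(3,2,3,7,5)] cl_add[OF f(3,3) ip jq] Q_simps by simp_all
  then show thesis
    using that[OF f(1-7)] cl_eq_iff[OF f(1,1) pi id_arr[OF perp_obj[OF f(1)]]]
      cl_eq_iff[OF f(2,2) qj id_arr[OF perp_obj[OF f(2)]]]
      cl_eq_iff[OF f(3,3) add_arr[OF ip jq] id_arr[OF perp_obj[OF f(3)]]] by simp
qed

text \<open>
  The closure condition is that of direct sums; with a zero second term it also covers isomorphic
  objects and direct summands. Zero objects of the quotient belong to \<open>X\<close>.
\<close>

lemma Q_subcategoryI:
  assumes B: "X \<subseteq> B" "B \<subseteq> \<A>"
    and closed: "\<And>D T T' a b a' b'. \<lbrakk>D \<in> \<A>; T \<in> B; T' \<in> B; a \<in> arr S D T; b \<in> arr S T D;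
      a' \<in> arr S D T'; b' \<in> arr S T' D;
      cong_mod S X D D ((b \<cdot> a) \<otimes>\<^bsub>Hom S D D\<^esub> (b' \<cdot> a')) (Idn S D)\<rbrakk> \<Longrightarrow> D \<in> B"
  shows "subcategory Q B"
proof -
  have obj: "D \<in> Obj S" if "D \<in> B" for D
    using that B(2) perp_obj by blast
  have retract: "D \<in> B"
    if D: "D \<in> \<A>" and T: "T \<in> B" and a: "a \<in> arr S D T" "b \<in> arr S T D"
      and c: "cong_mod S X D D (b \<cdot> a) (Idn S D)" for D T a b
  proof -
    note n = null_arr[OF arrD(1,2)[OF a(1)]]
    have "(b \<cdot> a) \<otimes>\<^bsub>Hom S D D\<^esub> (b \<cdot> \<one>\<^bsub>Hom S D T\<^esub>) = b \<cdot> a"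
      using comp_null_right[OF a(2) arrD(1)[OF a(1)]] add_null_right[OF comp_arr[OF a]] by simp
    then show ?thesis
      using closed[OF D T T a n a(2)] c by simp
  qed
  have iso: "D \<in> B" if "T \<in> B" "is_iso Q T D \<phi>" for T D \<phi>
    using that(2)
  proof (rule Q_isoE)
    fix f g assume "T \<in> \<A>" "D \<in> \<A>" "f \<in> arr S T D" "g \<in> arr S D T"
      "cong_mod S X T T (g \<cdot> f) (Idn S T)" "cong_mod S X D D (f \<cdot> g) (Idn S D)"
    then show ?thesis
      using retract[OF _ that(1)] by blast
  qed
  have zero: "Z \<in> B" if "zero_object Q Z" for Z
  proof -
    note Z = Q_zero_object[OF that]
    note Zo = perp_obj[OF Z(1)]
    have "Idn S Z \<in> factoring S X Z Z"
      using cong_null_iff[OF id_arr[OF Zo]] Z(2) by blast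
    then show ?thesis
      using zero_mod_X[OF Zo] B(1) by blast
  qed
  have sum: "D \<in> B" if "T \<in> B" "T' \<in> B" "direct_sum Q T T' D" for T T' D
    using that(3)
  proof (rule Q_direct_sumE)
    fix i j p q assume "D \<in> \<A>" "i \<in> arr S T D" "j \<in> arr S T' D" "p \<in> arr S D T" "q \<in> arr S D T'"
      "cong_mod S X D D ((i \<cdot> p) \<otimes>\<^bsub>Hom S D D\<^esub> (j \<cdot> q)) (Idn S D)"
    then show ?thesis
      using closed[OF _ that(1,2)] by blast
  qed
  have summand: "T \<in> B \<and> T' \<in> B" if "D \<in> B" "direct_sum Q T T' D" for T T' D
    using that(2)
  proof (rule Q_direct_sumE)
    fix i j p q assume "T \<in> \<A>" "T' \<in> \<A>"
      "i \<in> arr S T D" "j \<in> arr S T' D" "p \<in> arr S D T" "q \<in> arr S D T'"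
      "cong_mod S X T T (p \<cdot> i) (Idn S T)" "cong_mod S X T' T' (q \<cdot> j) (Idn S T')"
    then show ?thesis
      using retract[OF _ that(1)] by blast
  qed
  show ?thesis
    unfolding subcategory_def Q_simps
  proof (intro conjI allI impI)
    show "T' \<in> B" if "T \<in> B \<and> is_iso Q T T' \<phi>" for T T' \<phi>
      using iso[OF conjunct1[OF that] conjunct2[OF that]] .
    show "D \<in> B" if "T \<in> B \<and> T' \<in> B \<and> direct_sum Q T T' D" for T T' D
      using sum that by (elim conjE)
    show "T \<in> B" if "D \<in> B \<and> direct_sum Q T T' D" for T T' D
      using summand[OF conjunct1[OF that] conjunct2[OF that]] by (elim conjE)
    show "T' \<in> B" if "D \<in> B \<and> direct_sum Q T T' D" for T T' D
      using summand[OF conjunct1[OF that] conjunct2[OF that]] by (elim conjE)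
  qed (use B(2) zero in blast)+
qed

section \<open>The triangulated structure of the quotient\<close>

text \<open>
  Pulling back the chosen conflation \<open>A \<rightarrow> Mid A \<rightarrow> A\<langle>1\<rangle>\<close> induces an isomorphism from the morphisms
  \<open>Z \<rightarrow> A\<langle>1\<rangle>\<close> modulo \<open>X\<close> to \<open>\<bbbE>(Z, A)\<close>. The next three facts are its surjectivity, its kernel, and
  the consequence for vanishing.
\<close>

lemma shift_pull_surj:
  assumes "Z \<in> \<A>" "A \<in> \<A>" "\<epsilon> \<in> exts S Z A"
  obtains h where "h \<in> arr S Z (Sh A)" "Pull S h A (Sx A) = \<epsilon>"
proof -
  note s = shiftD[OF assms(2)]
  have "Push S Z (In A) \<epsilon> = \<one>\<^bsub>Ext S Z (Mid A)\<^esub>"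
    using ext_trivialD[OF perp_trivial(1)[OF assms(1) s(5)] push_ext[OF assms(3) etriangleD(1)[OF s(2)]]] .
  then show thesis
    using push_inflation_kernel[OF s(2) assms(3)] that by blast
qed

lemma shift_pull_kernel:
  assumes "A \<in> \<A>" "h \<in> arr S Z (Sh A)"
  shows "Pull S h A (Sx A) = \<one>\<^bsub>Ext S Z A\<^esub> \<longleftrightarrow> h \<in> factoring S X Z (Sh A)"
proof
  note s = shiftD[OF assms(1)]
  note t = etriangleD[OF s(2)]
  assume "Pull S h A (Sx A) = \<one>\<^bsub>Ext S Z A\<^esub>"
  then obtain g where "g \<in> arr S Z (Mid A)" "Out A \<cdot> g = h"
    using lift_along_deflation[OF s(2) assms(2)] by blast
  then show "h \<in> factoring S X Z (Sh A)"
    using factoringI[OF s(5) _ t(2)] by blast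
next
  note s = shiftD[OF assms(1)]
  note t = etriangleD[OF s(2)]
  assume "h \<in> factoring S X Z (Sh A)"
  then show "Pull S h A (Sx A) = \<one>\<^bsub>Ext S Z A\<^esub>"
  proof (rule factoringE)
    fix Y u v assume *: "Y \<in> X" "u \<in> arr S Z Y" "v \<in> arr S Y (Sh A)" "h = v \<cdot> u"
    obtain w where w: "w \<in> arr S Y (Mid A)" "v = Out A \<cdot> w"
      using s(4) *(1,3) unfolding right_approx_def by blast
    have "Pull S v A (Sx A) = Pull S w A (Pull S (Out A) A (Sx A))"
      using w pull_comp[OF t(3) t(2) w(1)] by simp
    also have "\<dots> = \<one>\<^bsub>Ext S Y A\<^esub>"
      using pull_deflation[OF s(2)] pull_null[OF t(4) w(1)] by simp
    finally show ?thesis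
      using pull_comp[OF t(3) *(3,2)] pull_null[OF t(4) *(2)] *(4) by simp
  qed
qed

lemma shift_hom_trivial_iff:
  assumes "Z \<in> \<A>" "A \<in> \<A>"
  shows "carrier (Hom Q Z (Sh A)) = {\<one>\<^bsub>Hom Q Z (Sh A)\<^esub>} \<longleftrightarrow> ext_trivial S Z A"
proof -
  note s = shiftD[OF assms(2)]
  note t = etriangleD[OF s(2)]
  note n = null_arr[OF perp_obj[OF assms(1)] t(6)]
  have cl_null: "cl \<one>\<^bsub>Hom S Z (Sh A)\<^esub> = \<one>\<^bsub>Hom Q Z (Sh A)\<^esub>"
    using cl_coset[OF assms(1) s(1) n] Q_null[OF assms(1) s(1)] hom_group[OF perp_obj[OF assms(1)] t(6)]
      factoring_arr arrD(3) group.coset_mult_one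
    by (metis comm_group_def subsetI)
  have "carrier (Hom Q Z (Sh A)) = arr Q Z (Sh A)"
    using assms(1) s(1) Q_simps by (auto simp: arr_def)
  also have "\<dots> = cl ` arr S Z (Sh A)"
    using assms(1) s(1) arr_Q by blast
  finally have "carrier (Hom Q Z (Sh A)) = {\<one>\<^bsub>Hom Q Z (Sh A)\<^esub>} \<longleftrightarrow>
      (\<forall>h \<in> arr S Z (Sh A). cl h = cl \<one>\<^bsub>Hom S Z (Sh A)\<^esub>)"
    using n cl_null by auto
  also have "\<dots> \<longleftrightarrow> (\<forall>h \<in> arr S Z (Sh A). h \<in> factoring S X Z (Sh A))"
    using cl_eq_iff[OF assms(1) s(1) _ n] cong_null_iff by blast
  also have "\<dots> \<longleftrightarrow> (\<forall>h \<in> arr S Z (Sh A). Pull S h A (Sx A) = \<one>\<^bsub>Ext S Z A\<^esub>)"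
    using shift_pull_kernel[OF assms(2)] by blast
  also have "\<dots> \<longleftrightarrow> ext_trivial S Z A"
  proof
    assume "\<forall>h \<in> arr S Z (Sh A). Pull S h A (Sx A) = \<one>\<^bsub>Ext S Z A\<^esub>"
    then show "ext_trivial S Z A"
      using shift_pull_surj[OF assms] by (metis ext_trivialI)
  next
    assume "ext_trivial S Z A"
    then show "\<forall>h \<in> arr S Z (Sh A). Pull S h A (Sx A) = \<one>\<^bsub>Ext S Z A\<^esub>"
      by (intro ballI ext_trivialD pull_ext[OF t(3)])
  qed
  finally show ?thesis .
qed

text \<open>
  A morphism congruent to \<open>1\<close> modulo \<open>X\<close> fixes the extension \<open>Sx A\<close>, since the left approximation
  \<open>In A\<close>, through which the difference factors, kills \<open>Sx A\<close>. Any \<open>g\<close> induced on \<open>A\<langle>1\<rangle>\<close> then also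
  fixes \<open>Sx A\<close> under pullback, so that \<open>g - 1\<close> factors through \<open>X\<close>.
\<close>

lemma quotient_shift_identity:
  assumes A: "A \<in> \<A>"
  shows "quotient_shift S \<A> X c (cl (Idn S A)) = cl (Idn S (Sh A))"
proof -
  note s = shiftD[OF A]
  note t = etriangleD[OF s(2)]
  note iA = id_arr[OF t(4)] and iS = id_arr[OF t(6)]
  have unique: "cl g = cl (Idn S (Sh A))"
    if f: "f \<in> cl (Idn S A)" "A1 \<in> \<A>" "B1 \<in> \<A>" "f \<in> arr S A1 B1"
      and m: "chosen_etriangle_morphism S c A1 (In A1) (Mid A1) (Out A1) (Sh A1) (Sx A1) B1 f g"
    for f g A1 B1
  proof -
    have fc: "cong_mod S X A A f (Idn S A)"
      using f(1) mem_cl_iff[OF A A iA] by simp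
    have AB: "A1 = A" "B1 = A"
      using hom_disjoint[OF f(4) cong_modD(1)[OF fc]] by simp_all
    have g: "g \<in> arr S (Sh A) (Sh A)" "Push S (Sh A) f (Sx A) = Pull S g A (Sx A)"
      using m unfolding AB chosen_etriangle_morphism_def etriangle_morphism_def ext_morphism_def by blast+
    obtain k where k: "k \<in> factoring S X A A" "f = k \<otimes>\<^bsub>Hom S A A\<^esub> Idn S A"
      using fc by (auto simp: cong_mod_def)
    obtain Y u v where Y: "Y \<in> X" "u \<in> arr S A Y" "v \<in> arr S Y A" "k = v \<cdot> u"
      using k(1) by (rule factoringE)
    obtain w where w: "w \<in> arr S (Mid A) Y" "u = w \<cdot> In A"
      using s(3) Y(1,2) unfolding left_approx_def by blast
    have "Push S (Sh A) u (Sx A) = \<one>\<^bsub>Ext S (Sh A) Y\<^esub>"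
      using w push_comp[OF t(3) t(1) w(1)] push_inflation[OF s(2)] push_null[OF t(6) w(1)] by simp
    then have "Push S (Sh A) k (Sx A) = \<one>\<^bsub>Ext S (Sh A) A\<^esub>"
      using push_comp[OF t(3) Y(2,3)] push_null[OF t(6) Y(3)] Y(4) by simp
    then have f_Sx: "Push S (Sh A) f (Sx A) = Sx A"
      using push_add[OF t(3) factoring_arr[OF k(1)] iA] k(2) push_id[OF t(3)] extsD(3)[OF t(3)]
        ext_group[OF t(6,4)] by (simp add: comm_group_def group.is_monoid)
    have sum: "g = (g \<otimes>\<^bsub>Hom S (Sh A) (Sh A)\<^esub> inv\<^bsub>Hom S (Sh A) (Sh A)\<^esub> Idn S (Sh A))
        \<otimes>\<^bsub>Hom S (Sh A) (Sh A)\<^esub> Idn S (Sh A)"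
    proof -
      interpret H: comm_group "Hom S (Sh A) (Sh A)"
        using hom_group[OF t(6,6)] .
      show ?thesis
        using arrD(3)[OF g(1)] arrD(3)[OF iS] by (simp add: H.m_assoc)
    qed
    define d where "d = g \<otimes>\<^bsub>Hom S (Sh A) (Sh A)\<^esub> inv\<^bsub>Hom S (Sh A) (Sh A)\<^esub> Idn S (Sh A)"
    have d: "d \<in> arr S (Sh A) (Sh A)"
      unfolding d_def by (rule add_arr[OF g(1) neg_arr[OF iS]])
    have "Sx A = Pull S d A (Sx A) \<otimes>\<^bsub>Ext S (Sh A) A\<^esub> Sx A"
      using pull_add[OF t(3) d iS] sum[folded d_def] pull_id[OF t(3)] f_Sx g(2) by simp
    then have "Pull S d A (Sx A) = \<one>\<^bsub>Ext S (Sh A) A\<^esub>"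
      using group.r_cancel_one'[OF comm_group.axioms(2)[OF ext_group[OF t(6,4)]] extsD(3)[OF t(3)]
          extsD(3)[OF pull_ext[OF t(3) d]]] by simp
    then have "cong_mod S X (Sh A) (Sh A) g (Idn S (Sh A))"
      using shift_pull_kernel[OF A d] sum[folded d_def] g(1) iS unfolding cong_mod_def by blast
    then show ?thesis
      using cl_eq_iff[OF s(1) s(1) g(1) iS] by simp
  qed
  have chosen: "chosen_etriangle_morphism S c A (In A) (Mid A) (Out A) (Sh A) (Sx A) A (Idn S A) (Idn S (Sh A))"
    unfolding chosen_etriangle_morphism_def etriangle_morphism_def ext_morphism_def
    using iA iS id_arr[OF t(5)] push_id[OF t(3)] pull_id[OF t(3)] id_left[OF t(1)] id_right[OF t(1)]
      id_left[OF t(2)] id_right[OF t(2)] by auto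
  have mem: "Idn S A \<in> cl (Idn S A)"
    using mem_cl_iff[OF A A iA] cong_refl[OF iA] by simp
  let ?K = "{cl g | f g A1 B1. f \<in> cl (Idn S A) \<and> A1 \<in> \<A> \<and> B1 \<in> \<A> \<and> f \<in> arr S A1 B1 \<and>
      chosen_etriangle_morphism S c A1 (In A1) (Mid A1) (Out A1) (Sh A1) (Sx A1) B1 f g}"
  have singleton: "K = {k}" if "\<And>x. x \<in> K \<Longrightarrow> x = k" "k \<in> K" for K :: "'m set set" and k
    using that by blast
  have "\<phi> = cl (Idn S (Sh A))" if "\<phi> \<in> ?K" for \<phi>
    using that by (elim CollectE exE conjE) (hypsubst, rule unique)
  moreover have "cl (Idn S (Sh A)) \<in> ?K"
    unfolding mem_Collect_eq
    by (rule exI[of _ "Idn S A"], rule exI[of _ "Idn S (Sh A)"], rule exI[of _ A], rule exI[of _ A])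
      (intro conjI refl mem A iA chosen)
  ultimately have "?K = {cl (Idn S (Sh A))}"
    by (rule singleton)
  then show ?thesis
    unfolding quotient_shift_def by simp
qed

text \<open>Every conflation in \<open>\<A>\<close> is automatically a standard triangle, since \<open>\<bbbE>(Z, X)\<close> vanishes for \<open>Z \<in> \<A>\<close>.\<close>

lemma conflation_triangle:
  assumes t: "etriangle S A f B g Z \<delta>" and A: "A \<in> \<A>" and B: "B \<in> \<A>" and Z: "Z \<in> \<A>"
  shows "\<exists>\<theta>. quotient_triangle S \<A> X c A (cl f) B (cl g) Z \<theta>"
proof -
  note T = etriangleD[OF t]
  note s = shiftD[OF A]
  obtain h where h: "h \<in> arr S Z (Sh A)" "Pull S h A (Sx A) = \<delta>"
    using shift_pull_surj[OF Z A T(3)] by blast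
  note i = id_arr[OF T(4)] id_arr[OF T(5)] id_arr[OF T(6)] id_arr[OF arrD(2)[OF h(1)]]
  have ext: "ext_morphism S A Z \<delta> A (Sh A) (Sx A) (Idn S A) h"
    unfolding ext_morphism_def using i(1) h push_id[OF T(3)] by simp
  obtain b where "b \<in> arr S B (Mid A)" "b \<cdot> f = In A \<cdot> Idn S A" "Out A \<cdot> b = h \<cdot> g"
    using real_morphism[OF t s(2) ext] by blast
  then have "chosen_etriangle_morphism S c A f B g Z \<delta> A (Idn S A) h"
    unfolding chosen_etriangle_morphism_def etriangle_morphism_def using ext by blast
  moreover have "\<exists>v \<in> arr S B Y. u = v \<cdot> f" if "Y \<in> X" "u \<in> arr S A Y" for Y u
    using extend_along_inflation[OF t that(2)
        ext_trivialD[OF perp_trivial(1)[OF Z that(1)] push_ext[OF T(3) that(2)]]] by metis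
  ultimately have "standard_triangle S \<A> X c A f B g Z h"
    unfolding standard_triangle_def using t A B Z by blast
  moreover have "cl f \<cdot>\<^bsub>Q\<^esub> cl (Idn S A) = cl (Idn S B) \<cdot>\<^bsub>Q\<^esub> cl f"
    using cl_comp[OF A A B i(1) T(1)] cl_comp[OF A B B T(1) i(2)] id_left[OF T(1)] id_right[OF T(1)] by simp
  moreover have "cl g \<cdot>\<^bsub>Q\<^esub> cl (Idn S B) = cl (Idn S Z) \<cdot>\<^bsub>Q\<^esub> cl g"
    using cl_comp[OF B B Z i(2) T(2)] cl_comp[OF B Z Z T(2) i(3)] id_left[OF T(2)] id_right[OF T(2)] by simp
  moreover have "cl h \<cdot>\<^bsub>Q\<^esub> cl (Idn S Z) = quotient_shift S \<A> X c (cl (Idn S A)) \<cdot>\<^bsub>Q\<^esub> cl h"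
    using cl_comp[OF Z Z s(1) i(3) h(1)] cl_comp[OF Z s(1) s(1) h(1) i(4)] id_left[OF h(1)] id_right[OF h(1)]
      quotient_shift_identity[OF A] by simp
  ultimately have "quotient_triangle S \<A> X c A (cl f) B (cl g) Z (cl h)"
    unfolding quotient_triangle_def Let_def
    using cl_arr[OF A B T(1)] cl_arr[OF B Z T(2)] cl_arr[OF Z s(1) h(1)]
      Q_identity_iso[OF A] Q_identity_iso[OF B] Q_identity_iso[OF Z] by blast
  then show ?thesis ..
qed

lemma quotient_triangle_conflation:
  assumes "quotient_triangle S \<A> X c A' \<phi> B' \<psi> Z' \<theta>"
  obtains A f B g Z \<delta> \<alpha> \<beta> \<gamma> where "etriangle S A f B g Z \<delta>"
    "is_iso Q A' A \<alpha>" "is_iso Q B' B \<beta>" "is_iso Q Z' Z \<gamma>"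
  using assms unfolding quotient_triangle_def Let_def standard_triangle_def by blast

text \<open>The cotorsion pair condition in \<open>\<A>/X\<close>, expressed through \<open>\<bbbE>\<close> and the triangles of the quotient.\<close>

lemma quotient_cotorsion_pair_iff:
  assumes "U \<subseteq> \<A>" "V \<subseteq> \<A>"
  shows "cotorsion_pair (ext_of_triangulated (triangulated_quotient S \<A> X c)) U V \<longleftrightarrow>
    subcategory Q U \<and> subcategory Q V \<and> (\<forall>Z \<in> U. \<forall>A \<in> V. ext_trivial S Z A) \<and>
    (\<forall>C \<in> \<A>. (\<exists>V0 \<phi> U0 \<psi> \<theta>. V0 \<in> V \<and> U0 \<in> U \<and> quotient_triangle S \<A> X c V0 \<phi> U0 \<psi> C \<theta>) \<and>
      (\<exists>\<phi> V1 \<psi> U1 \<theta>. V1 \<in> V \<and> U1 \<in> U \<and> quotient_triangle S \<A> X c C \<phi> V1 \<psi> U1 \<theta>))"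
proof -
  let ?M = "ext_of_triangulated (triangulated_quotient S \<A> X c)"
  have M: "Obj ?M = Obj Q" "Hom ?M = Hom Q" "Cmp ?M = Cmp Q" "Idn ?M = Idn Q"
    "Ext ?M = (\<lambda>Z A. Hom Q Z (Sh A))"
    "Real ?M = (\<lambda>Z A \<delta>. {(B, x, y). quotient_triangle S \<A> X c A x B y Z \<delta>})"
    by (simp_all add: ext_of_triangulated_def triangulated_quotient_def Let_def)
  have sub: "subcategory ?M B \<longleftrightarrow> subcategory Q B" for B
    unfolding subcategory_def is_iso_def zero_object_def direct_sum_def biproduct_def arr_def M ..
  have ext: "ext_vanishes ?M U V \<longleftrightarrow> (\<forall>Z \<in> U. \<forall>A \<in> V. ext_trivial S Z A)"
    unfolding ext_vanishes_def M using assms by (intro ball_cong refl shift_hom_trivial_iff) (erule (1) subsetD)+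
  have tri: "etriangle ?M A \<phi> B \<psi> Z \<theta> \<longleftrightarrow> quotient_triangle S \<A> X c A \<phi> B \<psi> Z \<theta>" for A \<phi> B \<psi> Z \<theta>
  proof -
    have "\<theta> \<in> exts ?M Z A" if *: "quotient_triangle S \<A> X c A \<phi> B \<psi> Z \<theta>"
    proof -
      have 1: "\<phi> \<in> arr Q A B" and 2: "\<theta> \<in> arr Q Z (Sh A)"
        using * unfolding quotient_triangle_def Let_def by blast+
      show ?thesis
        unfolding exts_def M using arrD(1)[OF 1] arrD(1,3)[OF 2] by blast
    qed
    then show ?thesis
      unfolding etriangle_def M by blast
  qed
  show ?thesis
    unfolding cotorsion_pair_def sub ext tri M Q_simps ..
qed

text \<open>
  In a cotorsion pair of \<open>S\<close> each class is the \<open>\<bbbE>\<close>-orthogonal of the other, and \<open>\<bbbE>\<close> vanishes on \<open>X\<close>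
  against \<open>\<A>\<close>; hence both classes are closed under the operations of the quotient category.
\<close>

lemma cotorsion_pair_to_quotient:
  assumes cp: "cotorsion_pair S U V" and U: "X \<subseteq> U" "U \<subseteq> \<A>"
  shows "X \<subseteq> V" "V \<subseteq> \<A>" "cotorsion_pair (ext_of_triangulated (triangulated_quotient S \<A> X c)) U V"
proof -
  note cpD = cotorsion_pairD[OF cp]
  have V_obj: "V \<subseteq> Obj S"
    using subcategoryD(1)[OF cpD(2)] .
  show V: "V \<subseteq> \<A>"
  proof
    fix v assume "v \<in> V"
    then show "v \<in> \<A>"
      unfolding perp_iff(2) using cpD(3) U(1) V_obj by blast
  qed
  show XV: "X \<subseteq> V"
  proof
    fix Y assume "Y \<in> X"
    then show "Y \<in> V"
      using cotorsion_pair_right_perp[OF cp subcat_obj] perp_trivial(1) U(2) by blast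
  qed
  have "subcategory Q U"
  proof (rule Q_subcategoryI[OF U])
    fix D T T' a b a' b'
    assume *: "D \<in> \<A>" "T \<in> U" "T' \<in> U" "a \<in> arr S D T" "b \<in> arr S T D" "a' \<in> arr S D T'" "b' \<in> arr S T' D"
      "cong_mod S X D D ((b \<cdot> a) \<otimes>\<^bsub>Hom S D D\<^esub> (b' \<cdot> a')) (Idn S D)"
    have "ext_trivial S D v" if "v \<in> V" for v
      using ext_trivial_left_mod_X[OF *(8,4-7) _ cpD(3)[OF *(2) that] cpD(3)[OF *(3) that]] that V by blast
    then show "D \<in> U"
      by (rule cotorsion_pair_left_perp[OF cp perp_obj[OF *(1)]])
  qed
  moreover have "subcategory Q V"
  proof (rule Q_subcategoryI[OF XV V])
    fix D T T' a b a' b'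
    assume *: "D \<in> \<A>" "T \<in> V" "T' \<in> V" "a \<in> arr S D T" "b \<in> arr S T D" "a' \<in> arr S D T'" "b' \<in> arr S T' D"
      "cong_mod S X D D ((b \<cdot> a) \<otimes>\<^bsub>Hom S D D\<^esub> (b' \<cdot> a')) (Idn S D)"
    have "ext_trivial S u D" if "u \<in> U" for u
      using ext_trivial_right_mod_X[OF *(8,4-7) _ cpD(3)[OF that *(2)] cpD(3)[OF that *(3)]] that U(2) by blast
    then show "D \<in> V"
      by (rule cotorsion_pair_right_perp[OF cp perp_obj[OF *(1)]])
  qed
  moreover have "\<exists>V0 \<phi> U0 \<psi> \<theta>. V0 \<in> V \<and> U0 \<in> U \<and> quotient_triangle S \<A> X c V0 \<phi> U0 \<psi> C \<theta>"
    if C: "C \<in> \<A>" for C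
  proof -
    obtain V0 x U0 y \<delta> where "V0 \<in> V" "U0 \<in> U" "etriangle S V0 x U0 y C \<delta>"
      using cpD(4)[OF perp_obj[OF C]] by blast
    moreover from this have "V0 \<in> \<A>" "U0 \<in> \<A>"
      using U(2) V by blast+
    ultimately show ?thesis
      using conflation_triangle[OF _ _ _ C] by metis
  qed
  moreover have "\<exists>\<phi> V1 \<psi> U1 \<theta>. V1 \<in> V \<and> U1 \<in> U \<and> quotient_triangle S \<A> X c C \<phi> V1 \<psi> U1 \<theta>"
    if C: "C \<in> \<A>" for C
  proof -
    obtain x V1 y U1 \<delta> where "V1 \<in> V" "U1 \<in> U" "etriangle S C x V1 y U1 \<delta>"
      using cpD(5)[OF perp_obj[OF C]] by blast
    moreover from this have "V1 \<in> \<A>" "U1 \<in> \<A>"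
      using U(2) V by blast+
    ultimately show ?thesis
      using conflation_triangle[OF _ C] by metis
  qed
  ultimately show "cotorsion_pair (ext_of_triangulated (triangulated_quotient S \<A> X c)) U V"
    unfolding quotient_cotorsion_pair_iff[OF U(2) V] using cpD(3) by blast
qed

text \<open>
  The isomorphisms of a quotient triangle with a standard one move its terms in \<open>U\<close> and \<open>V\<close> to terms
  in \<open>U\<close> and \<open>V\<close>, because these are closed under isomorphism in the quotient; only the given object is
  replaced by one that is merely isomorphic modulo \<open>X\<close>.
\<close>

lemma cotorsion_pair_from_quotient:
  assumes cp: "cotorsion_pair (ext_of_triangulated (triangulated_quotient S \<A> X c)) U V"
    and U: "subcategory S U" "X \<subseteq> U" "U \<subseteq> \<A>" and V: "subcategory S V" "X \<subseteq> V" "V \<subseteq> \<A>"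
  shows "cotorsion_pair S U V"
proof -
  note q = cp[unfolded quotient_cotorsion_pair_iff[OF U(3) V(3)]]
  have QU: "subcategory Q U" and QV: "subcategory Q V"
    using q by blast+
  have "\<exists>V0 x U0 y \<delta>. V0 \<in> V \<and> U0 \<in> U \<and> etriangle S V0 x U0 y C \<delta>" if C: "C \<in> Obj S" for C
  proof (rule precover_from_quotient[OF U(1,2) V _ C])
    fix D assume "D \<in> \<A>"
    then obtain V0 \<phi> U0 \<psi> \<theta> where *: "V0 \<in> V" "U0 \<in> U" "quotient_triangle S \<A> X c V0 \<phi> U0 \<psi> D \<theta>"
      using q by blast
    obtain A f B g Z \<delta> \<alpha> \<beta> \<gamma> where t: "etriangle S A f B g Z \<delta>"
      "is_iso Q V0 A \<alpha>" "is_iso Q U0 B \<beta>" "is_iso Q D Z \<gamma>"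
      using *(3) by (rule quotient_triangle_conflation)
    have "A \<in> V" "B \<in> U"
      using subcategoryD(2)[OF QV *(1) t(2)] subcategoryD(2)[OF QU *(2) t(3)] .
    then show "\<exists>A x B y Z \<delta> f g. A \<in> V \<and> B \<in> U \<and> etriangle S A x B y Z \<delta> \<and>
      f \<in> arr S D Z \<and> g \<in> arr S Z D \<and>
      cong_mod S X D D (g \<cdot> f) (Idn S D) \<and> cong_mod S X Z Z (f \<cdot> g) (Idn S Z)"
      using t(1) Q_isoE[OF t(4)] by metis
  qed
  moreover have "\<exists>x V1 y U1 \<delta>. V1 \<in> V \<and> U1 \<in> U \<and> etriangle S C x V1 y U1 \<delta>" if C: "C \<in> Obj S" for C
  proof (rule preenvelope_from_quotient[OF U V(1,2) _ C])
    fix D assume "D \<in> \<A>"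
    then obtain \<phi> V1 \<psi> U1 \<theta> where *: "V1 \<in> V" "U1 \<in> U" "quotient_triangle S \<A> X c D \<phi> V1 \<psi> U1 \<theta>"
      using q by blast
    obtain A f B g Z \<delta> \<alpha> \<beta> \<gamma> where t: "etriangle S A f B g Z \<delta>"
      "is_iso Q D A \<alpha>" "is_iso Q V1 B \<beta>" "is_iso Q U1 Z \<gamma>"
      using *(3) by (rule quotient_triangle_conflation)
    have "B \<in> V" "Z \<in> U"
      using subcategoryD(2)[OF QV *(1) t(3)] subcategoryD(2)[OF QU *(2) t(4)] .
    then show "\<exists>A x B y Z \<delta> f g. B \<in> V \<and> Z \<in> U \<and> etriangle S A x B y Z \<delta> \<and>
      f \<in> arr S D A \<and> g \<in> arr S A D \<and>
      cong_mod S X D D (g \<cdot> f) (Idn S D) \<and> cong_mod S X A A (f \<cdot> g) (Idn S A)"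
      using t(1) Q_isoE[OF t(2)] by metis
  qed
  ultimately show ?thesis
    unfolding cotorsion_pair_def ext_vanishes_iff[OF subcategoryD(1)[OF U(1)] subcategoryD(1)[OF V(1)]]
    using U(1) V(1) q by blast
qed

end

section \<open>Comparison of cotorsion pairs\<close>

text \<open>
  If the identity of \<open>K\<close> factors through \<open>X\<close>, then \<open>\<bbbE>(K, X) = 0\<close> by rigidity, so there is a chosen
  conflation \<open>K \<rightarrow> Y \<rightarrow> K\<langle>1\<rangle>\<close> with \<open>Y \<in> X\<close>. The identity of \<open>K\<close> factors through the left approximation
  \<open>K \<rightarrow> Y\<close>, hence the conflation splits and \<open>K\<close> is a direct summand of \<open>Y\<close>.
\<close>

lemma (in extriangulated_category) retract_of_subcategory:
  assumes X: "subcategory S X" and rigid: "rigid S X" and c: "valid_shift_choice S (left_perp S X) X c"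
    and K: "K \<in> Obj S" "Idn S K \<in> factoring S X K K"
  shows "K \<in> X"
proof -
  note XD = subcategoryD[OF X]
  obtain Y u v where Y: "Y \<in> X" "u \<in> arr S K Y" "v \<in> arr S Y K" "Idn S K = v \<cdot> u"
    using K(2) by (rule factoringE)
  have "ext_trivial S K Y'" if "Y' \<in> X" for Y'
  proof (rule ext_trivialI)
    fix \<epsilon> assume \<epsilon>: "\<epsilon> \<in> exts S K Y'"
    have "ext_trivial S Y Y'"
      using rigid Y(1) that ext_vanishes_iff[OF XD(1) XD(1)] by (simp add: rigid_def)
    then show "\<epsilon> = \<one>\<^bsub>Ext S K Y'\<^esub>"
      using pull_id[OF \<epsilon>] Y(4) pull_comp[OF \<epsilon> Y(3,2)] ext_trivialD pull_ext[OF \<epsilon> Y(3)]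
        pull_null[OF extsD(2)[OF \<epsilon>] Y(2)] by metis
  qed
  then have "K \<in> left_perp S X"
    using K(1) ext_vanishes_iff[of "{K}" X] XD(1) by (simp add: left_perp_def)
  then have t: "etriangle S K (chIn c K) (chMid c K) (chOut c K) (chShift c K) (chExt c K)"
    and l: "left_approx S X K (chMid c K) (chIn c K)"
    using c unfolding valid_shift_choice_def by blast+
  note T = etriangleD[OF t]
  obtain w where w: "w \<in> arr S (chMid c K) Y" "u = w \<cdot> chIn c K"
    using l Y(1,2) unfolding left_approx_def by blast
  have "chExt c K = Push S (chShift c K) v (Push S (chShift c K) w
      (Push S (chShift c K) (chIn c K) (chExt c K)))"
    using push_id[OF T(3)] Y(4) push_comp[OF T(3) Y(2,3)] w(2) push_comp[OF T(3) T(1) w(1)] by simp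
  also have "\<dots> = \<one>\<^bsub>Ext S (chShift c K) K\<^esub>"
    using push_inflation[OF t] push_null[OF T(6) w(1)] push_null[OF T(6) Y(3)] by simp
  finally have "direct_sum S K (chShift c K) (chMid c K)"
    using etriangle_direct_sum t by metis
  moreover have "chMid c K \<in> X"
    using l by (simp add: left_approx_def)
  ultimately show ?thesis
    using XD(5) by blast
qed

theorem theorem2p9:
  fixes S :: "('o, 'm, 'e) ext_data"
    and X U V I \<A> :: "'o set"
    and c :: "('o, 'm, 'e) shift_choice"
    and M :: "('o, 'm set) tri_data"
  assumes "extriangulated_category S" and "krull_schmidt S"
    and "enough_projectives S" and "enough_injectives S"
    and "subcategory S X" and "functorially_finite S X" and "rigid S X"
    and "\<A> = right_perp S X" and "right_perp S X = left_perp S X"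
    and "projective_objects S \<subseteq> X" and "injective_objects S \<subseteq> X"
    and "subcategory S U" and "subcategory S V"
    and "X \<subseteq> U" and "U \<subseteq> right_perp S X"
    and "valid_shift_choice S \<A> X c"
    and "M = triangulated_quotient S \<A> X c"
  shows "cotorsion_pair_with_core S U V I \<longleftrightarrow>
         X \<subseteq> V \<and> V \<subseteq> \<A> \<and> cotorsion_pair_with_core (ext_of_triangulated M) U V I"
proof -
  interpret extriangulated_category S
    by fact
  have X_obj: "X \<subseteq> Obj S"
    using assms(5) by (simp add: subcategory_def)
  have X_perp: "X \<subseteq> \<A>"
    using assms(7) X_obj unfolding assms(8) rigid_def right_perp_def ext_vanishes_def by blast
  have choice: "valid_shift_choice S (left_perp S X) X c"
    using assms(8,9,16) by simp
  have "rigid_subcategory_with_shift S X \<A> c"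
    using assms(1,3-6,8-11,16) X_perp retract_of_subcategory[OF assms(5,7) choice]
    by unfold_locales simp_all
  then interpret rigid_subcategory_with_shift S X \<A> c .
  have U: "U \<subseteq> \<A>"
    using assms(8,15) by simp
  show ?thesis
    unfolding cotorsion_pair_with_core_def assms(17)
    using cotorsion_pair_to_quotient[OF _ assms(14) U]
      cotorsion_pair_from_quotient[OF _ assms(12,14) U assms(13)] by blast
qed

end
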